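(* Let $c$ be a standard Coxeter element of $W$. The map $w\mapsto S(\Gamma(w))$ is a bijection from $NC(W,c)$ onto the set of faces of the simplicial complex $\Xi(W,c)$. Moreover, for $v,w\in NC(W,c)$ we have $v\sqsubset w$ if and only if $S(\Gamma(v))\subseteq S(\Gamma(w))$.
   Context: Let $W\subset O(V)$ be a finite real reflection group on a Euclidean space $V$ with simple system of reflections $S$, $n=|S|$, and $T$ the set of all reflections. $\ell$ is the Coxeter length with respect to $S$. For $t\in T$, $r(t)$ is its positive root (unit normal to the hyperplane fixed by $t$, positive with respect to $S$); $\langle\cdot|\cdot\rangle$ is the inner product. The absolute length $\ell_T(w)$ is the minimal number of reflections with product $w$; the absolute order is $v\le w$ iff $\ell_T(w)=\ell_T(v)+\ell_T(v^{-1}w)$. A standard Coxeter element is a product of all elements of $S$, each exactly once, in some order; $NC(W,c)=\{w\in W: w\le c\}$. Write $v\lessdot w$ if $v\le w$ and $\ell_T(v)=\ell_T(w)-1$ (then $vw^{-1}\in T$). The order $\sqsubset$ on $W$ is the reflexive-transitive closure of the relation "$v\lessdot w$ and $\ell(v)<\ell(w)$". For $w\in W$, $\Gamma(w)=\{v\in W:\ker(w-I)\subseteq\ker(v-I)\}$; it is a reflection group (parabolic subgroup) with reflections $T\cap\Gamma(w)$ and positive roots $\{r(t):t\in T\cap \Gamma(w)\}$; $S(\Gamma(w))$ denotes the set of reflections $t$ such that $r(t)$ belongs to the unique simple system of $\Gamma(w)$ contained in this set of positive roots. Two reflections $t,u$ are $c$-noncrossing if $tu\le c$ or $ut\le c$.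 $\Xi(W,c)$ is the flag simplicial complex with vertex set $T$ in which distinct $t,u$ are adjacent iff $t,u$ are $c$-noncrossing and $\langle r(t)|r(u)\rangle\le 0$; i.e. a subset $X\subseteq T$ is a face iff every pair of distinct elements of $X$ is adjacent. *)

theory Defs
  imports "HOL-Analysis.Analysis"
begin

definition reflection_along :: "'a::euclidean_space \<Rightarrow> 'a \<Rightarrow> 'a" where
  "reflection_along a = (\<lambda>x. x - (2 * (x \<bullet> a) / (a \<bullet> a)) *\<^sub>R a)"

definition is_reflection :: "('a::euclidean_space \<Rightarrow> 'a) \<Rightarrow> bool" where
  "is_reflection t \<longleftrightarrow> (\<exists>a. a \<noteq> 0 \<and> t = reflection_along a)"

definition reflections :: "('a::euclidean_space \<Rightarrow> 'a) set \<Rightarrow> ('a \<Rightarrow> 'a) set" where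
  "reflections W = {t \<in> W. is_reflection t}"

definition word_prod :: "('a \<Rightarrow> 'a) list \<Rightarrow> 'a \<Rightarrow> 'a" where
  "word_prod ts = foldr (\<circ>) ts id"

text \<open>Reflections are involutions, so the words in a set of reflections already form the group
  generated by it. In particular the last clause makes \<open>W\<close> a group under composition. The action
  on \<open>V\<close> need not be essential.\<close>

definition finite_reflection_group :: "('a::euclidean_space \<Rightarrow> 'a) set \<Rightarrow> bool" where
  "finite_reflection_group W \<longleftrightarrow>
     finite W \<and> (\<forall>w\<in>W. orthogonal_transformation w) \<and>
     W = {word_prod ts | ts. set ts \<subseteq> reflections W}"

text \<open>The root system is normalised to consist of unit vectors.\<close>

definition roots :: "('a::euclidean_space \<Rightarrow> 'a) set \<Rightarrow> 'a set" where
  "roots W = {a. norm a = 1 \<and> reflection_along a \<in> W}"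

definition nonneg_comb :: "'a::euclidean_space set \<Rightarrow> 'a \<Rightarrow> bool" where
  "nonneg_comb D a \<longleftrightarrow> (\<exists>k. (\<forall>d\<in>D. 0 \<le> k d) \<and> a = (\<Sum>d\<in>D. k d *\<^sub>R d))"

definition simple_system :: "('a::euclidean_space \<Rightarrow> 'a) set \<Rightarrow> 'a set \<Rightarrow> bool" where
  "simple_system W D \<longleftrightarrow>
     finite D \<and> D \<subseteq> roots W \<and> independent D \<and>
     (\<forall>a\<in>roots W. nonneg_comb D a \<or> nonneg_comb D (- a))"

text \<open>In what follows \<open>D\<close> is the simple system of roots of \<open>W\<close>. The corresponding set \<open>S\<close> of
  reflections does not determine the signs of the roots, so \<open>D\<close> rather than \<open>S\<close> is the
  parameter.\<close>

definition simple_reflections :: "'a::euclidean_space set \<Rightarrow> ('a \<Rightarrow> 'a) set" where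
  "simple_reflections D = reflection_along ` D"

definition pos_root :: "'a::euclidean_space set \<Rightarrow> ('a \<Rightarrow> 'a) \<Rightarrow> 'a" where
  "pos_root D t = (THE a. norm a = 1 \<and> nonneg_comb D a \<and> t = reflection_along a)"

definition word_length :: "('a \<Rightarrow> 'a) set \<Rightarrow> ('a \<Rightarrow> 'a) \<Rightarrow> nat" where
  "word_length A w = (LEAST k. \<exists>ts. set ts \<subseteq> A \<and> length ts = k \<and> word_prod ts = w)"

abbreviation coxeter_length :: "'a::euclidean_space set \<Rightarrow> ('a \<Rightarrow> 'a) \<Rightarrow> nat" where
  "coxeter_length D \<equiv> word_length (simple_reflections D)"

abbreviation abs_length :: "('a::euclidean_space \<Rightarrow> 'a) set \<Rightarrow> ('a \<Rightarrow> 'a) \<Rightarrow> nat" where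
  "abs_length W \<equiv> word_length (reflections W)"

definition abs_le ::
    "('a::euclidean_space \<Rightarrow> 'a) set \<Rightarrow> ('a \<Rightarrow> 'a) \<Rightarrow> ('a \<Rightarrow> 'a) \<Rightarrow> bool" where
  "abs_le W v w \<longleftrightarrow> v \<in> W \<and> w \<in> W \<and>
     abs_length W w = abs_length W v + abs_length W (inv v \<circ> w)"

definition abs_cover ::
    "('a::euclidean_space \<Rightarrow> 'a) set \<Rightarrow> ('a \<Rightarrow> 'a) \<Rightarrow> ('a \<Rightarrow> 'a) \<Rightarrow> bool" where
  "abs_cover W v w \<longleftrightarrow> abs_le W v w \<and> abs_length W w = abs_length W v + 1"

definition standard_coxeter_element ::
    "'a::euclidean_space set \<Rightarrow> ('a \<Rightarrow> 'a) \<Rightarrow> bool" where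
  "standard_coxeter_element D c \<longleftrightarrow>
     (\<exists>ss. distinct ss \<and> set ss = simple_reflections D \<and> c = word_prod ss)"

definition NC :: "('a::euclidean_space \<Rightarrow> 'a) set \<Rightarrow> ('a \<Rightarrow> 'a) \<Rightarrow> ('a \<Rightarrow> 'a) set" where
  "NC W c = {w \<in> W. abs_le W w c}"

definition sq_order ::
    "('a::euclidean_space \<Rightarrow> 'a) set \<Rightarrow> 'a set \<Rightarrow> ('a \<Rightarrow> 'a) \<Rightarrow> ('a \<Rightarrow> 'a) \<Rightarrow> bool" where
  "sq_order W D = (\<lambda>v w. abs_cover W v w \<and> coxeter_length D v < coxeter_length D w)\<^sup>*\<^sup>*"

definition Gamma_group :: "('a::euclidean_space \<Rightarrow> 'a) set \<Rightarrow> ('a \<Rightarrow> 'a) \<Rightarrow> ('a \<Rightarrow> 'a) set" where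
  "Gamma_group W w = {v \<in> W. {x. w x - x = 0} \<subseteq> {x. v x - x = 0}}"

text \<open>For a reflection subgroup \<open>G\<close> of \<open>W\<close>: the reflections whose positive root lies in the unique
  simple system of \<open>G\<close> consisting of roots that are positive for \<open>W\<close>.\<close>

definition induced_simple_reflections ::
    "'a::euclidean_space set \<Rightarrow> ('a \<Rightarrow> 'a) set \<Rightarrow> ('a \<Rightarrow> 'a) set" where
  "induced_simple_reflections D G =
     {t \<in> reflections G.
        pos_root D t \<in> (THE E. simple_system G E \<and> E \<subseteq> pos_root D ` reflections G)}"

definition noncrossing ::
    "('a::euclidean_space \<Rightarrow> 'a) set \<Rightarrow> ('a \<Rightarrow> 'a) \<Rightarrow> ('a \<Rightarrow> 'a) \<Rightarrow> ('a \<Rightarrow> 'a) \<Rightarrow> bool" where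
  "noncrossing W c t u \<longleftrightarrow> abs_le W (t \<circ> u) c \<or> abs_le W (u \<circ> t) c"

text \<open>\<open>Xi W D c\<close> is the set of faces of the complex (including the empty face).\<close>

definition Xi ::
    "('a::euclidean_space \<Rightarrow> 'a) set \<Rightarrow> 'a set \<Rightarrow> ('a \<Rightarrow> 'a) \<Rightarrow> ('a \<Rightarrow> 'a) set set" where
  "Xi W D c = {X. X \<subseteq> reflections W \<and>
     (\<forall>t\<in>X. \<forall>u\<in>X. t \<noteq> u \<longrightarrow>
        noncrossing W c t u \<and> pos_root D t \<bullet> pos_root D u \<le> 0)}"

end

theory Submission
  imports Defs
begin

text \<open>Noncrossing partitions are encoded by a bilinear form. For \<open>u, v\<close> in \<open>mov c = range (1 - c)\<close> let
  \<open>E u v = x \<bullet> v\<close> where \<open>x - c x = u\<close> (the Wall form); its symmetrization is the inner product, every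
  \<open>w \<le> c\<close> is determined by \<open>mov w\<close>, and \<open>t u \<le> c\<close> means \<open>E (r t) (r u) = 0\<close>. Cyclically rotating a reduced
  word of \<open>c\<close> carries each positive root to the initial simple root after a number of steps, its
  depth, and \<open>depth a < depth b\<close> implies \<open>E a b \<ge> 0 \<ge> E b a\<close>. Hence adjacent vertices \<open>a, b\<close> of the complex
  satisfy \<open>E a b = 0\<close> when \<open>depth a < depth b\<close>, so a face sorted by depth is a word for some \<open>w \<le> c\<close>.
  Conversely, the root of least depth in \<open>mov w\<close> is simple there and can be split off from \<open>w\<close>; by
  induction the simple system of \<open>\<Gamma>(w)\<close>, sorted by depth, is a word for \<open>w\<close>, and it is the only
  obtuse \<open>E\<close>-triangular set of positive roots spanning \<open>mov w\<close>. Since \<open>w\<close> is then a Coxeter element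
  of \<open>\<Gamma>(w)\<close>, the strong exchange property shows that the covers \<open>v \<lessdot> w\<close> with \<open>\<ell>(v) < \<ell>(w)\<close> are exactly
  the deletions of a letter from this word.\<close>

subsection \<open>Reflections\<close>

text \<open>The absolute order is defined by words inside \<open>W\<close>, whereas the Wall form
  describes the corresponding order on the whole orthogonal group. The link is
  \<open>dim (mov w)\<close>, a lower bound for the reflection length that must be attained by every
  element that occurs. Carter's lemma would give this for all of \<open>W\<close>; here it is needed
  only for Coxeter elements of the subsystems cut out by subspaces, whose defining word attains the
  bound. The work lies in showing that this class is closed under splitting off an arbitrary root of
  \<open>mov w\<close>. For the initial letter of a word this is clear, and rotating the word
  reduces every other root to that case at the price of a conjugation. The same rotation yields the
  signs of the Wall form and the generation of \<open>W\<close> by simple reflections, so one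
  construction serves three purposes.\<close>

lemma reflection_along_unit:
  "norm a = 1 \<Longrightarrow> reflection_along a x = x - (2 * (x \<bullet> a)) *\<^sub>R a"
  by (simp add: reflection_along_def dot_square_norm)

lemma linear_reflection_along: "linear (reflection_along a)"
  unfolding reflection_along_def
  by (rule linearI) (simp_all add: inner_left_distrib algebra_simps add_divide_distrib)

lemma reflection_along_involution [simp]: "reflection_along a (reflection_along a x) = x"
proof (cases "a = 0")
  case False
  then have "a \<bullet> a \<noteq> 0" by simp
  then show ?thesis
    by (simp add: reflection_along_def inner_diff_left algebra_simps diff_divide_distrib)
qed (simp add: reflection_along_def)

lemma orthogonal_reflection_along: "orthogonal_transformation (reflection_along a)"
proof (cases "a = 0")
  case False
  then have "a \<bullet> a \<noteq> 0" by simp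
  then have "reflection_along a v \<bullet> reflection_along a w = v \<bullet> w" for v w
    by (auto simp: reflection_along_def inner_diff_left inner_diff_right inner_commute field_simps)
  then show ?thesis unfolding orthogonal_transformation_def using linear_reflection_along by blast
next
  case True
  then show ?thesis
    by (simp add: reflection_along_def orthogonal_transformation_def linear_iff)
qed

lemma reflection_along_self [simp]: "reflection_along a a = - a"
  by (cases "a = 0") (simp_all add: reflection_along_def scaleR_2)

lemma reflection_along_minus [simp]: "reflection_along (- a) = reflection_along a"
  by (simp add: reflection_along_def)

lemma reflection_along_conj:
  assumes "orthogonal_transformation w"
  shows "w (reflection_along a x) = reflection_along (w a) (w x)"
proof -
  have "linear w" "\<And>v u. w v \<bullet> w u = v \<bullet> u"
    using assms by (auto simp: orthogonal_transformation_def)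
  then show ?thesis by (simp add: reflection_along_def linear_diff linear_scale)
qed

lemma reflection_along_eqD:
  assumes "norm a = 1" "norm b = 1" "reflection_along a = reflection_along b"
  shows "a = b \<or> a = - b"
proof -
  have "reflection_along b a = - a" using assms(3) by (metis reflection_along_self)
  then have "a - (2 * (a \<bullet> b)) *\<^sub>R b = - a" by (simp add: reflection_along_unit assms)
  then have "2 *\<^sub>R a = 2 *\<^sub>R ((a \<bullet> b) *\<^sub>R b)" by (simp add: scaleR_2 algebra_simps)
  then have eq: "a = (a \<bullet> b) *\<^sub>R b" by (metis real_vector.scale_cancel_left zero_neq_numeral)
  then have "\<bar>a \<bullet> b\<bar> = 1" using assms by (metis norm_scaleR mult.right_neutral)
  then show ?thesis using eq by (metis abs_eq_iff' abs_one scaleR_minus1_left scaleR_one)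
qed

subsection \<open>Words in reflections\<close>

abbreviation refl_word :: "'a::euclidean_space list \<Rightarrow> 'a \<Rightarrow> 'a" where
  "refl_word ys \<equiv> word_prod (map reflection_along ys)"

lemma word_prod_Nil [simp]: "word_prod [] = id"
  and word_prod_Cons [simp]: "word_prod (t # ts) = t \<circ> word_prod ts"
  by (simp_all add: word_prod_def)

lemma word_prod_append [simp]: "word_prod (ts @ us) = word_prod ts \<circ> word_prod us"
  by (induction ts) (simp_all add: o_assoc)

lemma orthogonal_refl_word: "orthogonal_transformation (refl_word ys)"
proof (induction ys)
  case Nil
  then show ?case by (simp add: orthogonal_transformation_def linear_iff)
next
  case (Cons a ys)
  then show ?case
    using orthogonal_transformation_compose[OF orthogonal_reflection_along Cons] by (simp add: o_def)
qed

lemma linear_refl_word: "linear (refl_word ys)"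
  using orthogonal_refl_word orthogonal_transformation_linear by blast

lemma refl_word_rev [simp]: "refl_word ys (refl_word (rev ys) x) = x"
  by (induction ys arbitrary: x) simp_all

lemma refl_word_rev' [simp]: "refl_word (rev ys) (refl_word ys x) = x"
  using refl_word_rev[of "rev ys" x] by (simp only: rev_rev_ident)

lemma inv_refl_word: "inv (refl_word ys) = refl_word (rev ys)"
  by (rule inv_unique_comp) (simp_all add: fun_eq_iff)

subsection \<open>Simple systems\<close>

text \<open>Roots are separated from the group so that \<open>P \<inter> U\<close>, for a subspace
  \<open>U\<close>, is an object of the same kind.\<close>

definition root_sys :: "'a::euclidean_space set \<Rightarrow> bool" where
  "root_sys P \<longleftrightarrow> finite P \<and> (\<forall>a\<in>P. norm a = 1) \<and> (\<forall>a\<in>P. \<forall>b\<in>P. reflection_along a b \<in> P)"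

definition root_basis :: "'a::euclidean_space set \<Rightarrow> 'a set \<Rightarrow> bool" where
  "root_basis P D \<longleftrightarrow>
     D \<subseteq> P \<and> independent D \<and> (\<forall>a\<in>P. nonneg_comb D a \<or> nonneg_comb D (- a))"

lemma simple_system_iff_root_basis: "simple_system W D \<longleftrightarrow> root_basis (roots W) D"
  using independent_imp_finite by (auto simp: simple_system_def root_basis_def)

lemma root_sys_uminus: "root_sys P \<Longrightarrow> a \<in> P \<Longrightarrow> - a \<in> P"
  unfolding root_sys_def by (metis reflection_along_self)

lemma root_sys_Int: "root_sys P \<Longrightarrow> subspace U \<Longrightarrow> root_sys (P \<inter> U)"
  unfolding root_sys_def
  by (auto simp: reflection_along_unit intro: subspace_diff subspace_scale)

lemma refl_word_root: "root_sys P \<Longrightarrow> set ys \<subseteq> P \<Longrightarrow> a \<in> P \<Longrightarrow> refl_word ys a \<in> P"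
  by (induction ys) (auto simp: root_sys_def)

section \<open>Cones over independent sets\<close>

lemma representation_comb:
  fixes D :: "'a::euclidean_space set"
  assumes "independent D" "d \<in> D"
  shows "representation D (\<Sum>e\<in>D. k e *\<^sub>R e) d = k d"
proof -
  have fin: "finite D" using independent_imp_finite[OF assms(1)] .
  have "representation D (\<Sum>e\<in>D. k e *\<^sub>R e) d = (\<Sum>e\<in>D. representation D (k e *\<^sub>R e) d)"
    using assms by (subst real_vector.representation_sum) (auto intro: span_scale span_base)
  also have "\<dots> = (\<Sum>e\<in>D. if e = d then k d else 0)"
    using assms
    by (intro sum.cong) (auto simp: real_vector.representation_scale real_vector.representation_basis span_base)
  finally show ?thesis using assms fin by simp
qed

lemma representation_expand:
  fixes D :: "'a::euclidean_space set"
  shows "independent D \<Longrightarrow> a \<in> span D \<Longrightarrow> (\<Sum>d\<in>D. representation D a d *\<^sub>R d) = a"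
  by (rule real_vector.sum_representation_eq) (auto simp: independent_imp_finite)

lemma nonneg_comb_iff:
  assumes "independent D"
  shows "nonneg_comb D a \<longleftrightarrow> a \<in> span D \<and> (\<forall>d\<in>D. 0 \<le> representation D a d)"
proof
  assume "nonneg_comb D a"
  then obtain k where "\<forall>d\<in>D. 0 \<le> k d" "a = (\<Sum>d\<in>D. k d *\<^sub>R d)"
    by (auto simp: nonneg_comb_def)
  then show "a \<in> span D \<and> (\<forall>d\<in>D. 0 \<le> representation D a d)"
    using assms by (auto simp: representation_comb intro: span_sum span_scale span_base)
next
  assume "a \<in> span D \<and> (\<forall>d\<in>D. 0 \<le> representation D a d)"
  then show "nonneg_comb D a"
    unfolding nonneg_comb_def using representation_expand[OF assms, of a] by metis
qed

lemma nonneg_comb_span: "nonneg_comb D a \<Longrightarrow> a \<in> span D"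
  by (auto simp: nonneg_comb_def intro: span_sum span_scale span_base)

lemma nonneg_comb_base: "finite D \<Longrightarrow> d \<in> D \<Longrightarrow> nonneg_comb D d"
  unfolding nonneg_comb_def
  by (rule exI[of _ "\<lambda>e. if e = d then 1 else 0"]) (simp add: if_distrib[of "\<lambda>x. x *\<^sub>R _"] cong: if_cong)

lemma nonneg_comb_zero: "nonneg_comb D 0"
  unfolding nonneg_comb_def by (rule exI[of _ "\<lambda>_. 0"]) simp

lemma nonneg_comb_add: "nonneg_comb D a \<Longrightarrow> nonneg_comb D b \<Longrightarrow> nonneg_comb D (a + b)"
  unfolding nonneg_comb_def
  apply (elim exE conjE)
  subgoal for k l
    by (rule exI[of _ "\<lambda>d. k d + l d"]) (simp add: scaleR_add_left sum.distrib)
  done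

lemma nonneg_comb_scale: "nonneg_comb D a \<Longrightarrow> 0 \<le> r \<Longrightarrow> nonneg_comb D (r *\<^sub>R a)"
  unfolding nonneg_comb_def
  apply (elim exE conjE)
  subgoal for k
    by (rule exI[of _ "\<lambda>d. r * k d"]) (simp add: scaleR_sum_right)
  done

lemma nonneg_comb_sum:
  "(\<And>i. i \<in> I \<Longrightarrow> nonneg_comb D (f i)) \<Longrightarrow> nonneg_comb D (\<Sum>i\<in>I. f i)"
  by (induction I rule: infinite_finite_induct) (auto intro: nonneg_comb_add nonneg_comb_zero)

lemma nonneg_comb_trans:
  "(\<And>d. d \<in> D \<Longrightarrow> nonneg_comb E d) \<Longrightarrow> nonneg_comb D a \<Longrightarrow> nonneg_comb E a"
  unfolding nonneg_comb_def[of D] by (auto intro!: nonneg_comb_sum nonneg_comb_scale)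

lemma nonneg_comb_antisym:
  assumes "independent D" "nonneg_comb D a" "nonneg_comb D (- a)"
  shows "a = 0"
proof -
  have s: "a \<in> span D" using assms(2) nonneg_comb_span by blast
  have "representation D a d = 0" if "d \<in> D" for d
  proof -
    have "0 \<le> representation D a d" using assms that by (simp add: nonneg_comb_iff)
    moreover have "0 \<le> representation D (- a) d" using assms that by (simp add: nonneg_comb_iff)
    ultimately show ?thesis using real_vector.representation_neg[OF assms(1) s] by simp
  qed
  then show ?thesis using representation_expand[OF assms(1) s] by simp
qed

lemma nonneg_comb_sum_eq_0:
  assumes "independent D" "finite I" "\<And>i. i \<in> I \<Longrightarrow> nonneg_comb D (f i)"
    "(\<Sum>i\<in>I. f i) = 0" "i \<in> I"
  shows "f i = 0"
proof (rule nonneg_comb_antisym[OF assms(1) assms(3)[OF assms(5)]])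
  have "- f i = (\<Sum>j\<in>I - {i}. f j)"
    using assms(4) sum.remove[OF assms(2,5), of f] by (metis minus_unique)
  then show "nonneg_comb D (- f i)" using assms(3) by (auto intro: nonneg_comb_sum)
qed

section \<open>Positive and simple roots\<close>

locale based_root_sys =
  fixes P D :: "'a::euclidean_space set"
  assumes rs: "root_sys P" and rb: "root_basis P D"
begin

definition pos :: "'a set" where "pos = {a \<in> P. nonneg_comb D a}"

lemma fin_P: "finite P" and norm_P: "a \<in> P \<Longrightarrow> norm a = 1"
  and refl_P: "a \<in> P \<Longrightarrow> b \<in> P \<Longrightarrow> reflection_along a b \<in> P"
  using rs by (auto simp: root_sys_def)

lemma indep_D: "independent D" and D_sub: "D \<subseteq> P" and pos_neg: "a \<in> P \<Longrightarrow> a \<in> pos \<or> - a \<in> pos"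
  using rb root_sys_uminus[OF rs] by (auto simp: root_basis_def pos_def)

lemma fin_D: "finite D"
  using D_sub fin_P finite_subset by blast

lemma pos_P: "a \<in> pos \<Longrightarrow> a \<in> P" by (simp add: pos_def)

lemma fin_pos: "finite pos" using fin_P by (simp add: pos_def)

lemma D_pos: "D \<subseteq> pos"
  using D_sub fin_D by (auto simp: pos_def intro: nonneg_comb_base)

lemma P_nonzero: "a \<in> P \<Longrightarrow> a \<noteq> 0"
  using norm_P by force

lemma pos_comb: "a \<in> pos \<Longrightarrow> nonneg_comb D a" by (simp add: pos_def)

lemma pos_not_neg: "a \<in> pos \<Longrightarrow> - a \<notin> pos"
  using nonneg_comb_antisym[OF indep_D, of a] P_nonzero by (auto simp: pos_def)

lemma P_span: "a \<in> P \<Longrightarrow> a \<in> span D"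
  using pos_neg[of a] nonneg_comb_span span_neg by (fastforce simp: pos_def)

text \<open>The coordinates of a root never have mixed signs, so a single positive one
  decides.\<close>

lemma pos_if_coord:
  assumes "a \<in> P" "d \<in> D" "representation D a d > 0"
  shows "a \<in> pos"
proof (rule ccontr)
  assume "a \<notin> pos"
  then have "nonneg_comb D (- a)" using pos_neg assms pos_comb by blast
  then have "0 \<le> representation D (- a) d"
    using nonneg_comb_iff[OF indep_D] assms by blast
  then show False
    using assms real_vector.representation_neg[OF indep_D P_span[OF assms(1)]] by simp
qed

lemma pos_scalar:
  assumes "a \<in> pos" "b \<in> pos" "a = k *\<^sub>R b"
  shows "a = b"
proof -
  have "\<bar>k\<bar> = 1" using assms norm_P[OF pos_P] by (metis norm_scaleR mult.right_neutral)
  then have "k = 1 \<or> k = - 1" by linarith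
  then show ?thesis using assms pos_not_neg[of b] by auto
qed

lemma representation_reflection:
  assumes "d \<in> D" "e \<in> D" "a \<in> span D"
  shows "representation D (reflection_along d a) e =
    representation D a e - (if e = d then 2 * (a \<bullet> d) else 0)"
proof -
  have "norm d = 1" using assms D_sub norm_P by blast
  then show ?thesis
    using assms indep_D
    by (simp add: reflection_along_unit real_vector.representation_diff span_scale span_base
        real_vector.representation_scale real_vector.representation_basis)
qed

text \<open>The reflection changes only the \<open>d\<close>-coordinate. A positive root other than
  \<open>d\<close> is no multiple of \<open>d\<close>, so it has another positive coordinate, and
  this one survives.\<close>

lemma simple_reflection_pos:
  assumes "d \<in> D" "a \<in> pos" "a \<noteq> d"
  shows "reflection_along d a \<in> pos"
proof -
  have a: "a \<in> P" "a \<in> span D" using assms P_span pos_P by auto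
  have "\<exists>e\<in>D. e \<noteq> d \<and> representation D a e > 0"
  proof (rule ccontr)
    assume "\<not> ?thesis"
    then have z: "representation D a e = 0" if "e \<in> D" "e \<noteq> d" for e
      using that assms(2) nonneg_comb_iff[OF indep_D, of a] pos_comb by force
    have "a = (\<Sum>e\<in>D. representation D a e *\<^sub>R e)"
      using representation_expand[OF indep_D a(2)] by simp
    also have "\<dots> = (\<Sum>e\<in>{d}. representation D a e *\<^sub>R e)"
      using assms(1) z fin_D by (intro sum.mono_neutral_right) auto
    finally have "a = representation D a d *\<^sub>R d" by simp
    then show False using pos_scalar assms D_pos by blast
  qed
  then obtain e where e: "e \<in> D" "e \<noteq> d" "representation D a e > 0" by blast
  show ?thesis
    by (rule pos_if_coord[OF _ e(1)])
      (use e assms a refl_P D_sub in \<open>auto simp: representation_reflection\<close>)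
qed

lemma basis_obtuse:
  assumes "d \<in> D" "e \<in> D" "d \<noteq> e"
  shows "d \<bullet> e \<le> 0"
proof -
  have "reflection_along d e \<in> pos" using assms simple_reflection_pos D_pos by auto
  then have "0 \<le> representation D (reflection_along d e) d"
    using assms nonneg_comb_iff[OF indep_D] pos_comb by blast
  also have "\<dots> = - (2 * (e \<bullet> d))"
    using assms indep_D by (simp add: representation_reflection span_base real_vector.representation_basis)
  finally show ?thesis by (simp add: inner_commute)
qed

text \<open>Sorting the relation by the signs of its coefficients gives \<open>p = q\<close> with
  \<open>p \<bullet> q \<le> 0\<close>, hence \<open>p = q = 0\<close>. Both are sums of vectors in
  the cone over \<open>D\<close>, which is pointed, so every summand vanishes.\<close>

lemma obtuse_pos_coeffs_0:
  assumes B: "B \<subseteq> pos" and ob: "\<And>a b. a \<in> B \<Longrightarrow> b \<in> B \<Longrightarrow> a \<noteq> b \<Longrightarrow> a \<bullet> b \<le> 0"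
    and z: "(\<Sum>b\<in>B. k b *\<^sub>R b) = 0" and "b \<in> B"
  shows "k b = 0"
proof -
  have fin: "finite B" using B fin_pos finite_subset by blast
  define p where "p = (\<Sum>b\<in>B. max (k b) 0 *\<^sub>R b)"
  define q where "q = (\<Sum>b\<in>B. max (- k b) 0 *\<^sub>R b)"
  have "p - q = (\<Sum>b\<in>B. k b *\<^sub>R b)"
    unfolding p_def q_def sum_subtractf[symmetric]
    by (intro sum.cong refl) (auto simp: max_def)
  then have "p = q" using z by simp
  have "p \<bullet> q = (\<Sum>a\<in>B. \<Sum>b\<in>B. max (k a) 0 * max (- k b) 0 * (a \<bullet> b))"
    unfolding p_def q_def
    by (subst sum.swap) (simp add: inner_sum_left inner_sum_right sum_distrib_left mult.assoc mult.left_commute)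
  also have "\<dots> \<le> 0"
  proof (intro sum_nonpos)
    fix a b assume "a \<in> B" "b \<in> B"
    then show "max (k a) 0 * max (- k b) 0 * (a \<bullet> b) \<le> 0"
      using ob[of a b] by (cases "a = b") (auto simp: max_def mult_nonneg_nonpos)
  qed
  finally have "p = 0" "q = 0" using \<open>p = q\<close> by (metis inner_eq_zero_iff inner_ge_zero order_antisym)+
  have nz: "b \<noteq> 0" using assms P_nonzero pos_P by blast
  have "max (k b) 0 *\<^sub>R b = 0"
    by (rule nonneg_comb_sum_eq_0[OF indep_D fin _ \<open>p = 0\<close>[unfolded p_def]])
      (use B assms in \<open>auto intro!: nonneg_comb_scale intro: pos_comb\<close>)
  moreover have "max (- k b) 0 *\<^sub>R b = 0"
    by (rule nonneg_comb_sum_eq_0[OF indep_D fin _ \<open>q = 0\<close>[unfolded q_def]])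
      (use B assms in \<open>auto intro!: nonneg_comb_scale intro: pos_comb\<close>)
  ultimately show ?thesis using nz by (auto simp: max_def split: if_splits)
qed

lemma obtuse_pos_independent:
  assumes "B \<subseteq> pos" "\<And>a b. a \<in> B \<Longrightarrow> b \<in> B \<Longrightarrow> a \<noteq> b \<Longrightarrow> a \<bullet> b \<le> 0"
  shows "independent B"
proof -
  have "finite B" using assms fin_pos finite_subset by blast
  then show ?thesis
    using obtuse_pos_coeffs_0[OF assms] real_vector.independent_if_scalars_zero by blast
qed

text \<open>A generating set of the positive roots in \<open>U\<close> of least cardinality works:
  minimality makes its members pairwise obtuse, and obtuse positive roots are independent.\<close>

lemma exists_pos_basis:
  assumes "subspace U"
  obtains B where "root_basis (P \<inter> U) B" "B \<subseteq> pos"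
proof -
  define gen where "gen B \<longleftrightarrow> B \<subseteq> pos \<inter> U \<and> (\<forall>a\<in>pos \<inter> U. nonneg_comb B a)" for B
  have "gen (pos \<inter> U)" using fin_pos by (auto simp: gen_def intro: nonneg_comb_base)
  from ex_has_least_nat[of gen, OF this, of card]
  obtain B where gB: "gen B" and min: "\<And>B'. gen B' \<Longrightarrow> card B \<le> card B'"
    by blast
  then have B: "B \<subseteq> pos \<inter> U \<and> (\<forall>a\<in>pos \<inter> U. nonneg_comb B a)" by (simp add: gen_def)
  have fin: "finite B" using B fin_pos finite_subset by blast
  have irredundant: False if "b \<in> B" "nonneg_comb (B - {b}) b" for b
  proof -
    have "nonneg_comb (B - {b}) d" if "d \<in> B" for d
      using that \<open>nonneg_comb (B - {b}) b\<close> fin by (cases "d = b") (auto intro: nonneg_comb_base)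
    then have "gen (B - {b})" unfolding gen_def using B nonneg_comb_trans by blast
    then have "card B \<le> card (B - {b})" by (rule min)
    then show False using fin that(1) by (metis card_Diff1_less leD)
  qed
  \<comment> \<open>Compare the coefficients of \<open>b\<close>: if \<open>k b < m\<close>, then
    \<open>b\<close> is generated by the other members of \<open>B\<close>; otherwise
    \<open>- (l *\<^sub>R a)\<close> lies in the positive cone.\<close>
  have split: False if b: "b \<in> B" "a \<in> B" "a \<noteq> b" and l: "l > 0" "m > 0"
      and nc: "nonneg_comb B (m *\<^sub>R b - l *\<^sub>R a)" for a b l m
  proof -
    obtain k where k: "\<forall>d\<in>B. 0 \<le> k d" "m *\<^sub>R b - l *\<^sub>R a = (\<Sum>d\<in>B. k d *\<^sub>R d)"
      using nc by (auto simp: nonneg_comb_def)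
    define r where "r = (\<Sum>d\<in>B - {b}. k d *\<^sub>R d)"
    have r: "nonneg_comb (B - {b}) r"
      unfolding r_def using k(1) fin by (auto intro!: nonneg_comb_sum nonneg_comb_scale intro: nonneg_comb_base)
    have eq: "(m - k b) *\<^sub>R b = l *\<^sub>R a + r"
      using k(2) sum.remove[OF fin b(1), of "\<lambda>d. k d *\<^sub>R d"]
      by (simp add: r_def algebra_simps)
    have la: "nonneg_comb (B - {b}) (l *\<^sub>R a)"
      using b l fin by (auto intro!: nonneg_comb_scale intro: nonneg_comb_base)
    show False
    proof (cases "k b < m")
      case True
      have "b = (1 / (m - k b)) *\<^sub>R ((m - k b) *\<^sub>R b)" using True by simp
      then have "b = (1 / (m - k b)) *\<^sub>R (l *\<^sub>R a + r)" using eq by simp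
      then have "nonneg_comb (B - {b}) b"
        using True nonneg_comb_scale[OF nonneg_comb_add[OF la r], of "1 / (m - k b)"] by simp
      then show False using irredundant b by blast
    next
      case False
      have posB: "nonneg_comb D d" if "d \<in> B" for d using B that pos_comb by blast
      have "nonneg_comb D (l *\<^sub>R a)" using l b posB by (simp add: nonneg_comb_scale)
      moreover have "nonneg_comb D (- (l *\<^sub>R a))"
      proof -
        have "- (l *\<^sub>R a) = r + (k b - m) *\<^sub>R b" using eq by (simp add: algebra_simps)
        moreover have "nonneg_comb D r" using r posB nonneg_comb_trans by blast
        ultimately show ?thesis using False b posB by (auto intro!: nonneg_comb_add nonneg_comb_scale)
      qed
      ultimately have "l *\<^sub>R a = 0" using nonneg_comb_antisym indep_D by blast
      then show False using l b B P_nonzero pos_P by auto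
    qed
  qed
  have ob: "a \<bullet> b \<le> 0" if ab: "a \<in> B" "b \<in> B" "a \<noteq> b" for a b
  proof (rule ccontr)
    assume "\<not> a \<bullet> b \<le> 0"
    then have l: "2 * (b \<bullet> a) > 0" by (simp add: inner_commute)
    have abP: "a \<in> P" "b \<in> P" "a \<in> U" "b \<in> U" using ab B pos_P by auto
    have r: "reflection_along a b = b - (2 * (b \<bullet> a)) *\<^sub>R a"
      using reflection_along_unit norm_P abP by blast
    then have rU: "reflection_along a b \<in> P" "reflection_along a b \<in> U" "- reflection_along a b \<in> U"
      using refl_P[of a b] abP assms subspace_neg by (auto simp: r intro: subspace_diff subspace_scale)
    \<comment> \<open>Were the angle acute, the reflected root or its negative would be a difference
      of positive multiples of \<open>a\<close> and \<open>b\<close> inside the cone;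
      \<open>split\<close> excludes both signs.\<close>
    then consider "reflection_along a b \<in> pos" | "- reflection_along a b \<in> pos" using pos_neg by blast
    then show False
    proof cases
      case 1
      then have "nonneg_comb B (1 *\<^sub>R b - (2 * (b \<bullet> a)) *\<^sub>R a)" using B rU r by simp
      then show False using split[of b a "2 * (b \<bullet> a)" 1] ab l by simp
    next
      case 2
      then have "nonneg_comb B ((2 * (b \<bullet> a)) *\<^sub>R a - 1 *\<^sub>R b)"
        using B rU r by (metis IntI minus_diff_eq scaleR_one)
      then show False using split[of a b 1 "2 * (b \<bullet> a)"] ab l by simp
    qed
  qed
  have "independent B" using obtuse_pos_independent ob B by blast
  moreover have "nonneg_comb B a \<or> nonneg_comb B (- a)" if "a \<in> P \<inter> U" for a
    using that B pos_neg assms subspace_neg by blast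
  ultimately have "root_basis (P \<inter> U) B" using B pos_P by (auto simp: root_basis_def)
  then show thesis using that B by blast
qed

lemma pos_basis_comb:
  assumes "root_basis Q B" "B \<subseteq> pos" "Q \<subseteq> P" "a \<in> Q" "a \<in> pos"
  shows "nonneg_comb B a"
proof (rule ccontr)
  assume "\<not> nonneg_comb B a"
  then have "nonneg_comb B (- a)" using assms by (auto simp: root_basis_def)
  then have "nonneg_comb D (- a)" using assms pos_comb nonneg_comb_trans by blast
  then have "- a \<in> pos" using assms root_sys_uminus[OF rs] by (auto simp: pos_def)
  then show False using pos_not_neg assms by blast
qed

text \<open>Simple roots span the extreme rays of the cone. In an expansion of \<open>b\<close> over
  \<open>C\<close> all terms have nonnegative coordinates over \<open>B\<close>, so those away from
  \<open>b\<close> cannot cancel: any \<open>c\<close> that occurs is a multiple of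
  \<open>b\<close>.\<close>

lemma pos_basis_subset:
  assumes "root_basis Q B" "B \<subseteq> pos" "root_basis Q C" "C \<subseteq> pos" "Q \<subseteq> P"
  shows "B \<subseteq> C"
proof
  fix b assume b: "b \<in> B"
  have iB: "independent B" and BQ: "B \<subseteq> Q" and iC: "independent C" and CQ: "C \<subseteq> Q"
    using assms by (auto simp: root_basis_def)
  have "nonneg_comb C b" using pos_basis_comb[OF assms(3,4,5)] b BQ assms by blast
  then obtain k where k: "\<forall>c\<in>C. 0 \<le> k c" "b = (\<Sum>c\<in>C. k c *\<^sub>R c)"
    by (auto simp: nonneg_comb_def)
  have cB: "nonneg_comb B c" if "c \<in> C" for c
    using that pos_basis_comb[OF assms(1,2,5)] CQ assms by blast
  have "b \<noteq> 0" using b assms P_nonzero pos_P by blast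
  then obtain c where c: "c \<in> C" "k c \<noteq> 0"
    using k(2) by (metis (no_types, lifting) scaleR_eq_0_iff sum.neutral)
  have fC: "finite C" using independent_imp_finite[OF iC] .
  have z: "representation B c e = 0" if e: "e \<in> B" "e \<noteq> b" for e
  proof -
    have "0 = representation B b e" using b e iB by (simp add: real_vector.representation_basis)
    also have "\<dots> = (\<Sum>c\<in>C. k c * representation B c e)"
      using iB cB[THEN nonneg_comb_span]
      by (subst k(2), subst real_vector.representation_sum)
        (auto simp: real_vector.representation_scale intro!: span_scale)
    finally have "(\<Sum>c\<in>C. k c * representation B c e) = 0" by simp
    moreover have "0 \<le> k d * representation B d e" if "d \<in> C" for d
      using that k(1) cB[OF that] e nonneg_comb_iff[OF iB] by auto
    ultimately have "k c * representation B c e = 0"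
      using sum_nonneg_0[OF fC _ _ c(1), of "\<lambda>c. k c * representation B c e"] by simp
    then show ?thesis using c by simp
  qed
  have "c = (\<Sum>e\<in>B. representation B c e *\<^sub>R e)"
    using representation_expand[OF iB nonneg_comb_span[OF cB[OF c(1)]]] by simp
  also have "\<dots> = (\<Sum>e\<in>{b}. representation B c e *\<^sub>R e)"
    using b z iB by (intro sum.mono_neutral_right) (auto simp: independent_imp_finite)
  finally have "c = representation B c b *\<^sub>R b" by simp
  then have "c = b" using pos_scalar assms b c by blast
  then show "b \<in> C" using c by simp
qed

lemma pos_basis_unique:
  assumes "root_basis Q B" "B \<subseteq> pos" "root_basis Q C" "C \<subseteq> pos" "Q \<subseteq> P"
  shows "B = C"
  using pos_basis_subset assms by blast

end

text \<open>On \<open>span C\<close> the coordinates over \<open>B\<close> and over \<open>C\<close>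
  agree, so signs are inherited.\<close>

lemma root_basis_face:
  assumes "root_basis P B" "C \<subseteq> B"
  shows "root_basis (P \<inter> span C) C"
proof -
  have iB: "independent B" and iC: "independent C"
    using assms independent_mono by (auto simp: root_basis_def)
  have "nonneg_comb C a" if a: "a \<in> span C" "nonneg_comb B a" for a
  proof -
    have "representation C a = representation B a"
      using real_vector.representation_extend[OF iB a(1) assms(2)] by simp
    then show ?thesis using a assms nonneg_comb_iff[OF iB] nonneg_comb_iff[OF iC] by auto
  qed
  moreover have "nonneg_comb B a \<or> nonneg_comb B (- a)" if "a \<in> P" for a
    using that assms(1) by (simp add: root_basis_def)
  moreover have "C \<subseteq> P \<inter> span C" using assms span_superset by (auto simp: root_basis_def)
  ultimately show ?thesis using iC span_neg unfolding root_basis_def by blast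
qed

subsection \<open>The Wall form\<close>

text \<open>For orthogonal \<open>w\<close> this is the orthogonal complement of the fixed
  space.\<close>

definition mov :: "('a::euclidean_space \<Rightarrow> 'a) \<Rightarrow> 'a set" where
  "mov w = range (\<lambda>x. x - w x)"

text \<open>The chosen preimage is immaterial for \<open>v \<in> mov w\<close>: two preimages differ
  by a fixed vector, which is orthogonal to \<open>mov w\<close>. Fixing the choice makes the form
  linear in \<open>v\<close> unconditionally.\<close>

definition wall :: "('a::euclidean_space \<Rightarrow> 'a) \<Rightarrow> 'a \<Rightarrow> 'a \<Rightarrow> real" where
  "wall w u v = (SOME x. x - w x = u) \<bullet> v"

lemma subspace_mov:
  assumes "orthogonal_transformation w"
  shows "subspace (mov w)"
proof -
  have "linear (\<lambda>x. x - w x)"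
    by (intro linear_compose_sub linear_ident orthogonal_transformation_linear assms)
  then show ?thesis unfolding mov_def by (intro linear_subspace_image) auto
qed

lemma inner_fixed_mov:
  assumes "orthogonal_transformation w" "w z = z" "u \<in> mov w"
  shows "z \<bullet> u = 0"
proof -
  obtain x where x: "u = x - w x" using assms(3) by (auto simp: mov_def)
  have "z \<bullet> w x = w z \<bullet> w x" using assms(2) by simp
  also have "\<dots> = z \<bullet> x" using assms(1) by (simp add: orthogonal_transformation_def)
  finally show ?thesis by (simp add: x inner_diff_right)
qed

lemma fixed_if_orthogonal_mov:
  assumes "orthogonal_transformation w" "\<And>u. u \<in> mov w \<Longrightarrow> z \<bullet> u = 0"
  shows "w z = z"
proof -
  have "z \<bullet> (z - w z) = 0" using assms(2) by (auto simp: mov_def)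
  moreover have "w z \<bullet> w z = z \<bullet> z" using assms(1) by (simp add: orthogonal_transformation_def)
  ultimately have "(z - w z) \<bullet> (z - w z) = 0"
    by (simp add: inner_diff_left inner_diff_right inner_commute)
  then show ?thesis by simp
qed

lemma mov_fixed_0:
  "orthogonal_transformation w \<Longrightarrow> u \<in> mov w \<Longrightarrow> w u = u \<Longrightarrow> u = 0"
  using inner_fixed_mov inner_eq_zero_iff by blast

lemma wall_eq:
  assumes w: "orthogonal_transformation w" and v: "v \<in> mov w"
  shows "wall w (x - w x) v = x \<bullet> v"
proof -
  define y where "y = (SOME y. y - w y = x - w x)"
  have y: "y - w y = x - w x" unfolding y_def by (rule someI[of _ x]) simp
  have "w (y - x) = w y - w x" using w by (simp add: orthogonal_transformation_linear linear_diff)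
  also have "\<dots> = y - (y - w y) - x + (x - w x)" by simp
  also have "\<dots> = y - x" unfolding y by simp
  finally have "w (y - x) = y - x" .
  then have "(y - x) \<bullet> v = 0" using inner_fixed_mov[OF w] v by blast
  then show ?thesis by (simp add: wall_def y_def[symmetric] inner_diff_left)
qed

lemma wall_scale_right: "wall w u (k *\<^sub>R v) = k * wall w u v"
  and wall_diff_right: "wall w u (v - v') = wall w u v - wall w u v'"
  and wall_sum_right: "wall w u (\<Sum>i\<in>I. f i) = (\<Sum>i\<in>I. wall w u (f i))"
  by (simp_all add: wall_def inner_diff_right inner_sum_right)

lemma wall_symmetrize:
  assumes w: "orthogonal_transformation w" and u: "u \<in> mov w" "v \<in> mov w"
  shows "wall w u v + wall w v u = u \<bullet> v"
proof -
  obtain x y where xy: "u = x - w x" "v = y - w y" using u by (auto simp: mov_def)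
  have "wall w u v = x \<bullet> v" "wall w v u = y \<bullet> u" using wall_eq[OF w] u xy by auto
  moreover have "w x \<bullet> w y = x \<bullet> y" using w by (simp add: orthogonal_transformation_def)
  ultimately show ?thesis
    by (simp add: xy inner_diff_left inner_diff_right inner_commute)
qed

lemma wall_self:
  "orthogonal_transformation w \<Longrightarrow> u \<in> mov w \<Longrightarrow> wall w u u = (u \<bullet> u) / 2"
  using wall_symmetrize[of w u u] by simp

lemma wall_swap:
  "orthogonal_transformation w \<Longrightarrow> u \<in> mov w \<Longrightarrow> v \<in> mov w \<Longrightarrow>
    wall w u v = u \<bullet> v - wall w v u"
  using wall_symmetrize[of w u v] by simp

text \<open>Linearity on the left is carried over from the right by the symmetrization, without
  handling preimages.\<close>

lemma wall_sum_left:
  assumes w: "orthogonal_transformation w" and v: "v \<in> mov w"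
    and f: "\<And>i. i \<in> I \<Longrightarrow> f i \<in> mov w"
  shows "wall w (\<Sum>i\<in>I. k i *\<^sub>R f i) v = (\<Sum>i\<in>I. k i * wall w (f i) v)"
proof -
  have "(\<Sum>i\<in>I. k i *\<^sub>R f i) \<in> mov w"
    using f by (intro subspace_sum[OF subspace_mov[OF w]] subspace_scale[OF subspace_mov[OF w]])
  then show ?thesis
    using f by (simp add: wall_swap[OF w _ v] wall_sum_right wall_scale_right inner_sum_left
        right_diff_distrib sum_subtractf)
qed

lemma wall_diff_left:
  "orthogonal_transformation w \<Longrightarrow> u \<in> mov w \<Longrightarrow> u' \<in> mov w \<Longrightarrow> v \<in> mov w \<Longrightarrow>
    wall w (u - u') v = wall w u v - wall w u' v"
  by (simp add: wall_swap[of w _ v] subspace_diff[OF subspace_mov] wall_diff_right inner_diff_left)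

lemma mov_conj:
  "mov (reflection_along a \<circ> w \<circ> reflection_along a) = reflection_along a ` mov w"
proof -
  let ?t = "reflection_along a"
  have *: "?t x - ?t (w (?t (?t x))) = ?t (x - w x)" for x
    by (simp add: linear_diff[OF linear_reflection_along])
  have "x - ?t (w (?t x)) = ?t (?t x - w (?t x))" for x
    by (simp add: linear_diff[OF linear_reflection_along])
  then show ?thesis by (auto simp: mov_def image_iff) (metis *)
qed

lemma wall_conj:
  assumes w: "orthogonal_transformation w" and u: "u \<in> mov w" "v \<in> mov w"
  shows "wall (reflection_along a \<circ> w \<circ> reflection_along a) (reflection_along a u) (reflection_along a v)
    = wall w u v"
proof -
  let ?t = "reflection_along a"
  have w': "orthogonal_transformation (?t \<circ> w \<circ> ?t)"
    by (intro orthogonal_transformation_compose orthogonal_reflection_along w)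
  obtain x where x: "u = x - w x" using u by (auto simp: mov_def)
  have "?t u = ?t x - (?t \<circ> w \<circ> ?t) (?t x)"
    by (simp add: x linear_diff[OF linear_reflection_along])
  moreover have "?t v \<in> mov (?t \<circ> w \<circ> ?t)" unfolding mov_conj using u by blast
  ultimately have "wall (?t \<circ> w \<circ> ?t) (?t u) (?t v) = ?t x \<bullet> ?t v"
    using wall_eq[OF w'] by metis
  also have "\<dots> = x \<bullet> v"
    using orthogonal_reflection_along[of a] by (simp add: orthogonal_transformation_def)
  finally show ?thesis using wall_eq[OF w u(2)] x by simp
qed

text \<open>This is the Brady--Watt order on the orthogonal group: \<open>v\<close> is determined by \<open>w\<close> and the
  subspace \<open>mov v\<close>.\<close>

definition wall_le :: "('a::euclidean_space \<Rightarrow> 'a) \<Rightarrow> ('a \<Rightarrow> 'a) \<Rightarrow> bool" where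
  "wall_le v w \<longleftrightarrow> mov v \<subseteq> mov w \<and> (\<forall>u\<in>mov v. \<forall>u'\<in>mov v. wall v u u' = wall w u u')"

lemma wall_le_refl: "wall_le w w" by (simp add: wall_le_def)

lemma wall_le_trans: "wall_le u v \<Longrightarrow> wall_le v w \<Longrightarrow> wall_le u w"
  unfolding wall_le_def by (metis subset_eq)

text \<open>For \<open>d = v' x - v x\<close> the forms of \<open>v\<close> and \<open>v'\<close>
  both evaluate to \<open>x \<bullet> d\<close>, so the form of \<open>w\<close> vanishes at
  \<open>d, d\<close>. Its value there is half the squared norm.\<close>

lemma wall_le_unique:
  assumes o: "orthogonal_transformation v" "orthogonal_transformation v'" "orthogonal_transformation w"
    and le: "wall_le v w" "wall_le v' w" and eq: "mov v = mov v'"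
  shows "v = v'"
proof
  fix x
  let ?u = "x - v x" let ?u' = "x - v' x"
  have u: "?u \<in> mov v" by (simp add: mov_def)
  have "?u' \<in> mov v'" by (simp add: mov_def)
  then have u': "?u' \<in> mov v" using eq by simp
  have uw: "?u \<in> mov w" "?u' \<in> mov w" using u u' le by (auto simp: wall_le_def)
  have d: "?u - ?u' \<in> mov v" using u u' subspace_diff subspace_mov o by blast
  then have dw: "?u - ?u' \<in> mov w" using le by (auto simp: wall_le_def)
  have "wall w ?u (?u - ?u') = wall v ?u (?u - ?u')" using le(1) u d unfolding wall_le_def by metis
  also have "\<dots> = x \<bullet> (?u - ?u')" by (rule wall_eq[OF o(1) d])
  finally have "wall w ?u (?u - ?u') = x \<bullet> (?u - ?u')" .
  moreover have "wall w ?u' (?u - ?u') = wall v' ?u' (?u - ?u')"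
    using le(2) u' d eq unfolding wall_le_def by metis
  moreover have "wall v' ?u' (?u - ?u') = x \<bullet> (?u - ?u')" by (rule wall_eq[OF o(2)]) (use d eq in simp)
  ultimately have "wall w (?u - ?u') (?u - ?u') = 0" using wall_diff_left[OF o(3) uw dw] by simp
  then have "?u - ?u' = 0" using wall_self[OF o(3) dw] by simp
  then show "v x = v' x" by simp
qed

text \<open>Let \<open>a = y - w y\<close>. Then \<open>y\<close> is fixed by the product with the
  reflection, which cuts \<open>mov w\<close> down to the vectors orthogonal to \<open>y\<close>,
  and \<open>y \<bullet> u\<close> is \<open>wall w a u\<close>.\<close>

lemma
  assumes w: "orthogonal_transformation w" and a: "norm a = 1" "a \<in> mov w"
  shows mov_peel: "mov (reflection_along a \<circ> w) = {u \<in> mov w. wall w a u = 0}"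
    and wall_le_peel: "wall_le (reflection_along a \<circ> w) w"
proof -
  let ?t = "reflection_along a"
  have tw: "orthogonal_transformation (?t \<circ> w)"
    by (intro orthogonal_transformation_compose orthogonal_reflection_along w)
  have wi: "w x \<bullet> w z = x \<bullet> z" for x z using w by (simp add: orthogonal_transformation_def)
  have wl: "linear w" by (rule orthogonal_transformation_linear[OF w])
  obtain y where y: "a = y - w y" using a by (auto simp: mov_def)
  have wa: "wall w a u = y \<bullet> u" if "u \<in> mov w" for u using wall_eq[OF w that] y by simp
  have ya: "y \<bullet> a = 1 / 2" using wa[OF a(2)] wall_self[OF w a(2)] a(1) by (simp add: dot_square_norm)
  \<comment> \<open>The shift along \<open>y\<close> makes the displacement of \<open>s x\<close>
    under \<open>w\<close> equal to that of \<open>x\<close> under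
    \<open>?t \<circ> w\<close>.\<close>
  define s where "s x = x + (2 * (w x \<bullet> a)) *\<^sub>R y" for x
  have s: "x - ?t (w x) = s x - w (s x)" for x
  proof -
    have "x - ?t (w x) = x - w x + (2 * (w x \<bullet> a)) *\<^sub>R a"
      by (simp add: reflection_along_unit[OF a(1)])
    also have "\<dots> = s x - w (s x)"
      using y by (simp add: s_def linear_add[OF wl] linear_scale[OF wl] scaleR_diff_right
          flip: diff_diff_eq)
    finally show ?thesis .
  qed
  have z: "y \<bullet> (x - ?t (w x)) = 0" for x
    by (simp add: reflection_along_unit[OF a(1)] inner_diff_right ya)
      (simp add: y inner_diff_right wi inner_commute)
  have sub: "u \<in> mov w \<and> wall w a u = 0" if u: "u \<in> mov (?t \<circ> w)" for u
  proof -
    obtain x where x: "u = x - ?t (w x)" using u by (auto simp: mov_def)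
    then have "u \<in> mov w" using s by (auto simp: mov_def)
    then show ?thesis using wa z x by auto
  qed
  moreover have "u \<in> mov (?t \<circ> w)" if u: "u \<in> mov w" "wall w a u = 0" for u
  proof -
    obtain x where x: "u = x - w x" using u by (auto simp: mov_def)
    have "w x \<bullet> a = w x \<bullet> y - x \<bullet> y" by (simp add: y inner_diff_right wi)
    also have "\<dots> = - (y \<bullet> u)" by (simp add: x inner_diff_right inner_commute)
    finally have "?t (w x) = w x" using wa u by (simp add: reflection_along_unit[OF a(1)])
    then have "u = x - (?t \<circ> w) x" by (simp add: x)
    then show ?thesis unfolding mov_def by blast
  qed
  ultimately show "mov (?t \<circ> w) = {u \<in> mov w. wall w a u = 0}" by blast
  show "wall_le (?t \<circ> w) w"
    unfolding wall_le_def
  proof (intro conjI ballI)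
    show "mov (?t \<circ> w) \<subseteq> mov w" using sub by blast
    fix u v assume u: "u \<in> mov (?t \<circ> w)" and v: "v \<in> mov (?t \<circ> w)"
    obtain x where x: "u = x - (?t \<circ> w) x" using u by (auto simp: mov_def)
    have "wall (?t \<circ> w) u v = x \<bullet> v" unfolding x by (rule wall_eq[OF tw v])
    also have "\<dots> = s x \<bullet> v" using wa[of v] sub[OF v] by (simp add: s_def inner_add_left)
    also have "\<dots> = wall w u v" using wall_eq[OF w, of v "s x"] sub[OF v] s x by simp
    finally show "wall (?t \<circ> w) u v = wall w u v" .
  qed
qed

text \<open>This is the projection along \<open>a\<close>; the factor 2 is the inverse of
  \<open>wall w a a\<close>.\<close>

lemma mov_peel_decomp:
  assumes w: "orthogonal_transformation w" and a: "norm a = 1" "a \<in> mov w" and u: "u \<in> mov w"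
  shows "u - (2 * wall w a u) *\<^sub>R a \<in> mov (reflection_along a \<circ> w)"
proof -
  have "wall w a a = 1 / 2" using wall_self[OF w a(2)] a(1) by (simp add: dot_square_norm)
  moreover have "u - (2 * wall w a u) *\<^sub>R a \<in> mov w"
    using subspace_mov[OF w] a u by (simp add: subspace_diff subspace_scale)
  ultimately show ?thesis by (simp add: mov_peel[OF w a] wall_diff_right wall_scale_right)
qed

lemma dim_mov_peel:
  assumes w: "orthogonal_transformation w" and a: "norm a = 1" "a \<in> mov w"
  shows "dim (mov w) = Suc (dim (mov (reflection_along a \<circ> w)))"
proof -
  let ?M = "mov (reflection_along a \<circ> w)"
  have s: "subspace ?M" "subspace (mov w)"
    by (intro subspace_mov orthogonal_transformation_compose orthogonal_reflection_along w)+
  have "wall w a a \<noteq> 0" using wall_self[OF w a(2)] a(1) by (simp add: dot_square_norm)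
  then have "a \<notin> span ?M" using s mov_peel[OF w a] by (simp add: span_eq_iff[THEN iffD2])
  then have "dim (insert a ?M) = Suc (dim ?M)" by (simp add: dim_insert)
  moreover have "span (insert a ?M) = mov w"
  proof
    show "span (insert a ?M) \<subseteq> mov w"
      using a s mov_peel[OF w a] by (intro span_minimal) auto
    show "mov w \<subseteq> span (insert a ?M)"
    proof
      fix u assume "u \<in> mov w"
      then have "u - (2 * wall w a u) *\<^sub>R a \<in> span ?M"
        using mov_peel_decomp[OF w a] span_base by blast
      then show "u \<in> span (insert a ?M)" by (auto simp: span_breakdown_eq)
    qed
  qed
  ultimately show ?thesis by (metis dim_span)
qed

section \<open>Moved spaces of words\<close>

lemma mov_refl_word_subset: "mov (refl_word ys) \<subseteq> span (set ys)"
proof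
  fix u assume "u \<in> mov (refl_word ys)"
  then obtain x where x: "u = x - refl_word ys x" by (auto simp: mov_def)
  have "x - refl_word ys x \<in> span (set ys)"
  proof (induction ys)
    case Nil
    then show ?case by (simp add: span_zero)
  next
    case (Cons y ys)
    have "x - refl_word ys x \<in> span (set (y # ys))"
      using Cons span_mono[of "set ys" "set (y # ys)"] by auto
    moreover have "z - reflection_along y z \<in> span (set (y # ys))" for z
      by (simp add: reflection_along_def span_scale span_base)
    ultimately have "(x - refl_word ys x) + (refl_word ys x - reflection_along y (refl_word ys x))
        \<in> span (set (y # ys))" using span_add by blast
    then show ?case by simp
  qed
  then show "u \<in> span (set ys)" using x by simp
qed

text \<open>If the word fixes \<open>x\<close>, then its tail acts on \<open>x\<close> as the
  reflection in the first letter \<open>z\<close>. The displacement is a multiple of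
  \<open>z\<close> in the span of the later letters, so it is 0 by independence.\<close>

lemma refl_word_fixed:
  assumes "distinct ys" "independent (set ys)" "refl_word ys x = x" "y \<in> set ys"
  shows "x \<bullet> y = 0"
  using assms
proof (induction ys)
  case (Cons z ys)
  have iz: "independent (set ys)" "z \<notin> span (set ys)" "z \<noteq> 0"
    using Cons.prems independent_insert[of z "set ys"] span_zero by auto
  have eq: "refl_word ys x = reflection_along z x"
    using Cons.prems(3) reflection_along_involution by (metis comp_apply list.map(2) word_prod_Cons)
  have "x - refl_word ys x \<in> span (set ys)" using mov_refl_word_subset[of ys] by (auto simp: mov_def)
  then have k: "(2 * (x \<bullet> z) / (z \<bullet> z)) *\<^sub>R z \<in> span (set ys)"
    unfolding eq by (simp add: reflection_along_def)
  have xz: "x \<bullet> z = 0"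
  proof (rule ccontr)
    assume "x \<bullet> z \<noteq> 0"
    then have "2 * (x \<bullet> z) / (z \<bullet> z) \<noteq> 0" using iz by simp
    then show False using k iz span_scale[OF k, of "inverse (2 * (x \<bullet> z) / (z \<bullet> z))"] by simp
  qed
  then have "refl_word ys x = x" using eq by (simp add: reflection_along_def)
  then show ?case using Cons xz iz by auto
qed simp

text \<open>A vector of the span orthogonal to the moved space is fixed by the word, hence
  orthogonal to all letters and therefore 0.\<close>

lemma mov_refl_word:
  assumes "distinct ys" "independent (set ys)"
  shows "mov (refl_word ys) = span (set ys)"
proof (rule ccontr)
  assume ne: "mov (refl_word ys) \<noteq> span (set ys)"
  have s: "subspace (mov (refl_word ys))" by (rule subspace_mov[OF orthogonal_refl_word])
  have "mov (refl_word ys) \<subset> span (set ys)" using ne mov_refl_word_subset by blast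
  then have "span (mov (refl_word ys)) \<subset> span (set ys)" using s by (metis span_eq_iff)
  then obtain z where z: "z \<noteq> 0" "z \<in> span (set ys)" "\<And>u. u \<in> span (mov (refl_word ys)) \<Longrightarrow> orthogonal z u"
    using orthogonal_to_subspace_exists_gen[of "mov (refl_word ys)" "set ys"] by blast
  have "refl_word ys z = z"
  proof (rule fixed_if_orthogonal_mov[OF orthogonal_refl_word])
    show "z \<bullet> u = 0" if "u \<in> mov (refl_word ys)" for u
      using z(3)[OF span_base[OF that]] by (simp add: orthogonal_def)
  qed
  then have "orthogonal z y" if "y \<in> set ys" for y
    using refl_word_fixed[OF assms] that by (simp add: orthogonal_def)
  then have "orthogonal z z" using z(2) orthogonal_to_span by blast
  then show False using z(1) by (simp add: orthogonal_def)
qed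

text \<open>The Wall form is triangular in the letters of an independent word: removing the first
  letter leaves a word that moves exactly the span of the others.\<close>

lemma wall_refl_word_hd:
  assumes "distinct (y # ys)" "independent (set (y # ys))" "norm y = 1" "u \<in> span (set ys)"
  shows "wall (refl_word (y # ys)) y u = 0"
proof -
  have "y \<in> mov (refl_word (y # ys))" using mov_refl_word[OF assms(1,2)] by (simp add: span_base)
  then have "mov (reflection_along y \<circ> refl_word (y # ys))
      = {u \<in> mov (refl_word (y # ys)). wall (refl_word (y # ys)) y u = 0}"
    by (rule mov_peel[OF orthogonal_refl_word assms(3)])
  moreover have "reflection_along y \<circ> refl_word (y # ys) = refl_word ys" by (simp add: fun_eq_iff)
  moreover have "mov (refl_word ys) = span (set ys)"
    using assms independent_mono[OF assms(2)] by (intro mov_refl_word) auto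
  ultimately show ?thesis using assms(4) by auto
qed

lemma dim_mov_refl_word_le: "dim (mov (refl_word ys)) \<le> length ys"
proof -
  have "dim (mov (refl_word ys)) \<le> card (set ys)"
    using dim_le_card[OF mov_refl_word_subset] by simp
  then show ?thesis using card_length le_trans by blast
qed

lemma minimal_refl_word:
  assumes "length ys = dim (mov (refl_word ys))"
  shows "distinct ys" "independent (set ys)" "mov (refl_word ys) = span (set ys)"
proof -
  have 1: "dim (mov (refl_word ys)) \<le> dim (span (set ys))"
    by (rule dim_subset[OF mov_refl_word_subset])
  have 2: "dim (span (set ys)) \<le> card (set ys)" by (simp add: dim_le_card')
  have c: "card (set ys) = length ys" using 1 2 assms card_length[of ys] by linarith
  then show d: "distinct ys" by (rule card_distinct)
  show i: "independent (set ys)"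
    by (rule card_le_dim_spanning[of _ "span (set ys)"]) (use 1 c assms span_superset in auto)
  show "mov (refl_word ys) = span (set ys)" by (rule mov_refl_word[OF d i])
qed

subsection \<open>Rotating a Coxeter word\<close>

text \<open>Conjugation by the initial letter turns a Coxeter word \<open>y # ys\<close> into \<open>ys @ [y]\<close> and keeps every
  positive root other than \<open>y\<close> positive. \<open>hit m ys a\<close> says that \<open>a\<close> is carried to the initial letter
  for the first time after \<open>m\<close> such steps; ordering the positive roots by \<open>m\<close> gives the reflection
  order of the \<open>c\<close>-sorting words.\<close>

primrec hit :: "nat \<Rightarrow> 'a::euclidean_space list \<Rightarrow> 'a \<Rightarrow> bool" where
  "hit 0 ys a \<longleftrightarrow> a = hd ys"
| "hit (Suc m) ys a \<longleftrightarrow> a \<noteq> hd ys \<and> hit m (rotate1 ys) (reflection_along (hd ys) a)"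

lemma hit_inj: "hit m ys a \<Longrightarrow> hit m ys b \<Longrightarrow> a = b"
proof (induction m arbitrary: ys a b)
  case (Suc m)
  then have "reflection_along (hd ys) a = reflection_along (hd ys) b" by auto
  then show ?case by (metis reflection_along_involution)
qed simp

lemma refl_word_rotate1:
  "refl_word (ys @ [y]) = reflection_along y \<circ> refl_word (y # ys) \<circ> reflection_along y"
  by (simp add: fun_eq_iff)

lemma reflection_along_reflection:
  "reflection_along (reflection_along y a) = reflection_along y \<circ> reflection_along a \<circ> reflection_along y"
proof
  fix x
  show "reflection_along (reflection_along y a) x
      = (reflection_along y \<circ> reflection_along a \<circ> reflection_along y) x"
    using reflection_along_conj[OF orthogonal_reflection_along, of y a "reflection_along y x"] by simp
qed

text \<open>Undoing the rotations conjugates the reflection in a letter by letters. This later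
  yields generation by simple reflections.\<close>

lemma hit_reflection_word:
  "hit m ys a \<Longrightarrow> ys \<noteq> [] \<Longrightarrow> \<exists>zs. set zs \<subseteq> set ys \<and> reflection_along a = refl_word zs"
proof (induction m arbitrary: ys a)
  case 0
  then show ?case by (intro exI[of _ "[hd ys]"]) auto
next
  case (Suc m)
  let ?y = "hd ys"
  obtain zs where zs: "set zs \<subseteq> set (rotate1 ys)"
    "reflection_along (reflection_along ?y a) = refl_word zs"
    using Suc.IH[of "rotate1 ys" "reflection_along ?y a"] Suc.prems by (auto simp: rotate1_is_Nil_conv)
  have "reflection_along a = reflection_along ?y \<circ> refl_word zs \<circ> reflection_along ?y"
    unfolding zs(2)[symmetric] reflection_along_reflection by (simp add: fun_eq_iff)
  then show ?case using zs(1) Suc.prems(2)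
    by (intro exI[of _ "?y # zs @ [?y]"]) (auto simp: o_assoc)
qed

section \<open>Depth of positive roots and signs of the Wall form\<close>

context based_root_sys
begin

text \<open>A root that never becomes the initial letter stays positive under each simple reflection
  of the rotation.\<close>

lemma exists_hit_aux:
  assumes "set (us @ vs) = D" "a \<in> pos" "\<And>m. \<not> hit m (us @ vs) a"
  shows "refl_word (rev us) a \<in> pos \<and> (\<forall>m. \<not> hit m (vs @ us) (refl_word (rev us) a))"
  using assms
proof (induction us arbitrary: vs a)
  case (Cons u us)
  have "a \<noteq> u" using Cons.prems(3)[of 0] by simp
  then have "reflection_along u a \<in> pos" using Cons.prems by (intro simple_reflection_pos) auto
  moreover have "\<not> hit m (us @ (vs @ [u])) (reflection_along u a)" for m
    using Cons.prems(3)[of "Suc m"] \<open>a \<noteq> u\<close> by simp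
  ultimately show ?case using Cons.IH[of "vs @ [u]" "reflection_along u a"] Cons.prems(1) by auto
qed simp

text \<open>The roots that never hit would be permuted by the Coxeter element \<open>c\<close>, so that their sum
  would be a fixed vector of \<open>c\<close> in \<open>mov c\<close>.\<close>

lemma exists_hit:
  assumes ys: "distinct ys" "set ys = D" and "a \<in> pos"
  shows "\<exists>m. hit m ys a"
proof (rule ccontr)
  assume no_hit: "\<not> ?thesis"
  define A where "A = {a \<in> pos. \<forall>m. \<not> hit m ys a}"
  have aA: "a \<in> A" using assms no_hit by (simp add: A_def)
  let ?f = "refl_word (rev ys)" let ?c = "refl_word ys"
  have fin: "finite A" using fin_pos by (simp add: A_def)
  \<comment> \<open>A full turn of the rotation acts as the inverse of the Coxeter element.\<close>
  have sub: "?f ` A \<subseteq> A" using exists_hit_aux[of ys "[]"] ys by (auto simp: A_def)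
  have inj: "inj_on ?f A" by (rule inj_on_inverseI[of _ ?c]) simp
  have im: "?f ` A = A" using endo_inj_surj[OF fin sub inj] .
  define s where "s = (\<Sum>x\<in>A. x)"
  have "?f s = (\<Sum>x\<in>A. ?f x)" unfolding s_def by (rule linear_sum[OF linear_refl_word])
  also have "\<dots> = s" using sum.reindex[OF inj, of "\<lambda>x. x"] im by (simp add: s_def)
  finally have "?c s = s" using refl_word_rev[of ys s] by simp
  moreover have "s \<in> mov ?c"
    using mov_refl_word[of ys] ys indep_D P_span pos_P
    by (auto simp: s_def A_def intro!: span_sum)
  ultimately have "s = 0" using mov_fixed_0[OF orthogonal_refl_word] by blast
  then have "a = 0"
    using nonneg_comb_sum_eq_0[OF indep_D fin, of "\<lambda>x. x" a] aA pos_comb by (auto simp: s_def A_def)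
  then show False using assms P_nonzero pos_P by blast
qed

text \<open>By triangularity only the \<open>y\<close>-term of \<open>a\<close> contributes, and
  \<open>wall\<close> at \<open>y, y\<close> is 1/2.\<close>

lemma wall_hd:
  assumes ys: "distinct (y # ys)" "set (y # ys) = D" and a: "a \<in> span D"
  shows "wall (refl_word (y # ys)) y a = representation D a y / 2"
proof -
  let ?c = "refl_word (y # ys)"
  have mov: "mov ?c = span D" using mov_refl_word[OF ys(1)] ys(2) indep_D by simp
  have y: "y \<in> D" "norm y = 1" using ys D_sub norm_P by auto
  have "wall ?c y a = (\<Sum>d\<in>D. wall ?c y (representation D a d *\<^sub>R d))"
    using representation_expand[OF indep_D a] wall_sum_right by metis
  also have "\<dots> = (\<Sum>d\<in>D. representation D a d * wall ?c y d)" by (simp add: wall_scale_right)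
  also have "\<dots> = (\<Sum>d\<in>{y}. representation D a d * wall ?c y d)"
  proof (rule sum.mono_neutral_right[OF fin_D])
    show "\<forall>d\<in>D - {y}. representation D a d * wall ?c y d = 0"
    proof
      fix d assume "d \<in> D - {y}"
      then have "d \<in> span (set ys)" using ys by (auto intro: span_base)
      then show "representation D a d * wall ?c y d = 0"
        using wall_refl_word_hd[of y ys d] ys indep_D y by simp
    qed
  qed (use y in auto)
  also have "\<dots> = representation D a y / 2"
    using wall_self[OF orthogonal_refl_word, of y "y # ys"] mov y by (simp add: span_base dot_square_norm)
  finally show ?thesis .
qed

text \<open>Rotation preserves the form, so \<open>a\<close> may be taken as the initial letter.
  Then the first value is half the \<open>a\<close>-coordinate of \<open>b\<close>, and by
  symmetrization the second is minus half the \<open>a\<close>-coordinate of the reflected root.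
  Both \<open>b\<close> and its reflection are positive.\<close>

lemma wall_hit:
  assumes "distinct ys" "set ys = D" "a \<in> pos" "b \<in> pos" "hit m ys a" "hit m' ys b" "m < m'"
  shows "0 \<le> wall (refl_word ys) a b \<and> wall (refl_word ys) b a \<le> 0"
  using assms
proof (induction m arbitrary: m' ys a b)
  case 0
  obtain k where k: "m' = Suc k" using 0 by (cases m') auto
  \<comment> \<open>The empty word is impossible, since \<open>span {}\<close> contains no root;
    hence \<open>hd ys\<close> is a genuine letter.\<close>
  have "a \<in> D" if "ys = []" using that 0 P_span[OF pos_P, of a] P_nonzero[OF pos_P, of a] by auto
  then obtain zs where ys: "ys = a # zs" using 0 by (cases ys) auto
  have ab: "b \<noteq> a" "a \<in> D" "norm a = 1" using 0 k ys norm_P pos_P by auto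
  have sp: "a \<in> span D" "b \<in> span D" using 0 P_span pos_P by auto
  have mov: "mov (refl_word ys) = span D" using mov_refl_word[of ys] 0 indep_D by simp
  have 1: "wall (refl_word ys) a b = representation D b a / 2"
    unfolding ys by (rule wall_hd) (use 0 ys sp in auto)
  have "0 \<le> representation D b a"
    using 0 ab nonneg_comb_iff[OF indep_D] pos_comb by blast
  moreover have "0 \<le> representation D (reflection_along a b) a"
    using simple_reflection_pos[of a b] 0 ab nonneg_comb_iff[OF indep_D] pos_comb by blast
  then have "2 * (b \<bullet> a) \<le> representation D b a"
    using ab sp by (simp add: representation_reflection)
  ultimately show ?case
    using 1 wall_swap[OF orthogonal_refl_word, of b ys a] mov sp by simp
next
  case (Suc m)
  obtain k where k: "m' = Suc k" using Suc by (cases m') auto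
  have "ys \<noteq> []" using Suc P_span[OF pos_P, of a] P_nonzero[OF pos_P, of a] by auto
  then obtain y zs where ys: "ys = y # zs" by (cases ys) auto
  let ?t = "reflection_along y"
  have y: "y \<in> D" "a \<noteq> y" "b \<noteq> y" using Suc.prems ys k by auto
  have tp: "?t a \<in> pos" "?t b \<in> pos" using y Suc.prems simple_reflection_pos by auto
  have sp: "a \<in> span D" "b \<in> span D" using Suc.prems P_span pos_P by auto
  have mov: "mov (refl_word ys) = span D" using mov_refl_word[of ys] Suc.prems indep_D by simp
  have IH: "0 \<le> wall (refl_word (zs @ [y])) (?t a) (?t b) \<and> wall (refl_word (zs @ [y])) (?t b) (?t a) \<le> 0"
    by (rule Suc.IH[of _ _ _ k]) (use Suc.prems ys k tp in auto)
  have conj: "wall (refl_word (zs @ [y])) (?t u) (?t v) = wall (refl_word ys) u v"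
    if "u \<in> span D" "v \<in> span D" for u v
    unfolding refl_word_rotate1 ys[symmetric]
    by (rule wall_conj[OF orthogonal_refl_word]) (use that mov in auto)
  show ?case using IH conj sp by simp
qed

end

subsection \<open>Quasi-Coxeter elements of root subsystems\<close>

text \<open>The letters form a simple system for all roots of \<open>P\<close> in their span, so the
  word gives a Coxeter element of this subsystem.\<close>

definition coxeter_word :: "'a::euclidean_space set \<Rightarrow> 'a list \<Rightarrow> bool" where
  "coxeter_word P ys \<longleftrightarrow> distinct ys \<and> root_basis (P \<inter> span (set ys)) (set ys)"

text \<open>The simple system need not consist of roots that are positive for an ambient simple system;
  this makes the notion invariant under conjugation.\<close>

definition quasi_coxeter :: "'a::euclidean_space set \<Rightarrow> ('a \<Rightarrow> 'a) \<Rightarrow> bool" where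
  "quasi_coxeter P w \<longleftrightarrow> (\<exists>ys. coxeter_word P ys \<and> w = refl_word ys)"

lemma coxeter_word_map:
  assumes P: "root_sys P" and y: "y \<in> P" and zs: "coxeter_word P zs"
  shows "coxeter_word P (map (reflection_along y) zs)"
proof -
  let ?t = "reflection_along y"
  have inj: "inj ?t" by (rule inj_on_inverseI[of _ ?t]) simp
  have tP: "?t a \<in> P" if "a \<in> P" for a using that P y by (simp add: root_sys_def)
  have rb: "root_basis (P \<inter> span (set zs)) (set zs)" and d: "distinct zs"
    using zs by (auto simp: coxeter_word_def)
  have nc: "nonneg_comb (?t ` set zs) (?t a)" if a: "nonneg_comb (set zs) a" for a
  proof -
    obtain k where k: "\<forall>d\<in>set zs. 0 \<le> k d" "a = (\<Sum>d\<in>set zs. k d *\<^sub>R d)"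
      using a by (auto simp: nonneg_comb_def)
    have "?t a = (\<Sum>d\<in>set zs. k d *\<^sub>R ?t d)"
      by (simp add: k linear_sum[OF linear_reflection_along] linear_scale[OF linear_reflection_along])
    then show ?thesis using k by (auto intro!: nonneg_comb_sum nonneg_comb_scale intro: nonneg_comb_base)
  qed
  have sp: "span (?t ` set zs) = ?t ` span (set zs)"
    by (rule linear_span_image[OF linear_reflection_along])
  have "nonneg_comb (?t ` set zs) a \<or> nonneg_comb (?t ` set zs) (- a)"
    if a: "a \<in> P" "a \<in> span (?t ` set zs)" for a
  proof -
    have "?t a \<in> P \<inter> span (set zs)" using a tP unfolding sp by auto
    then have "nonneg_comb (set zs) (?t a) \<or> nonneg_comb (set zs) (- ?t a)"
      using rb by (auto simp: root_basis_def)
    then show ?thesis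
      using nc[of "?t a"] nc[of "- ?t a"] linear_neg[OF linear_reflection_along, of y "?t a"] by auto
  qed
  moreover have "independent (?t ` set zs)"
    using rb inj linear_reflection_along
    by (intro linear_independent_injective_image) (auto simp: root_basis_def intro: inj_on_subset)
  moreover have "?t ` set zs \<subseteq> P \<inter> span (?t ` set zs)"
    using rb tP by (auto simp: root_basis_def intro: span_base)
  ultimately show ?thesis
    using d inj_on_subset[OF inj subset_UNIV]
    by (auto simp: coxeter_word_def root_basis_def distinct_map)
qed

lemma refl_word_map:
  "refl_word (map (reflection_along y) zs) = reflection_along y \<circ> refl_word zs \<circ> reflection_along y"
  by (induction zs) (simp_all add: reflection_along_reflection fun_eq_iff)

text \<open>Dropping the initial letter leaves a face of the simple system. Other roots are rotated
  to the front first, and the resulting word is conjugated back letter by letter.\<close>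

lemma coxeter_word_peel:
  assumes P: "root_sys P"
  shows "hit m ys a \<Longrightarrow> ys \<noteq> [] \<Longrightarrow> coxeter_word P ys \<Longrightarrow> quasi_coxeter P (reflection_along a \<circ> refl_word ys)"
proof (induction m arbitrary: ys a)
  case 0
  then obtain y zs where ys: "ys = y # zs" "a = y" by (cases ys) auto
  have sub: "span (set zs) \<subseteq> span (set ys)" using ys by (intro span_mono) auto
  have "root_basis (P \<inter> span (set ys) \<inter> span (set zs)) (set zs)"
    by (rule root_basis_face[of _ "set ys"]) (use 0 ys in \<open>auto simp: coxeter_word_def\<close>)
  also have "P \<inter> span (set ys) \<inter> span (set zs) = P \<inter> span (set zs)" using sub by blast
  finally have "coxeter_word P zs" using 0 ys by (simp add: coxeter_word_def)
  moreover have "reflection_along a \<circ> refl_word ys = refl_word zs" by (simp add: ys fun_eq_iff)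
  ultimately show ?case by (auto simp: quasi_coxeter_def)
next
  case (Suc m)
  obtain y zs where ys: "ys = y # zs" using Suc.prems by (cases ys) auto
  let ?t = "reflection_along y"
  have y: "y \<in> P" using Suc.prems ys by (auto simp: coxeter_word_def root_basis_def)
  have "coxeter_word P (zs @ [y])" using Suc.prems ys by (simp add: coxeter_word_def)
  then have "quasi_coxeter P (reflection_along (?t a) \<circ> refl_word (zs @ [y]))"
    by (intro Suc.IH) (use Suc.prems ys in auto)
  then obtain us where us: "coxeter_word P us"
    "reflection_along (?t a) \<circ> refl_word (zs @ [y]) = refl_word us" by (auto simp: quasi_coxeter_def)
  have "reflection_along a \<circ> refl_word ys = ?t \<circ> refl_word us \<circ> ?t"
    unfolding us(2)[symmetric] refl_word_rotate1 reflection_along_reflection ys by (simp add: fun_eq_iff)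
  then show ?case
    unfolding quasi_coxeter_def using coxeter_word_map[OF P y us(1)] refl_word_map by metis
qed

lemma quasi_coxeter_orthogonal: "quasi_coxeter P w \<Longrightarrow> orthogonal_transformation w"
  using orthogonal_refl_word by (auto simp: quasi_coxeter_def)

lemma coxeter_word_mov: "coxeter_word P ys \<Longrightarrow> mov (refl_word ys) = span (set ys)"
  by (rule mov_refl_word) (auto simp: coxeter_word_def root_basis_def)

lemma coxeter_word_length:
  assumes "coxeter_word P ys"
  shows "length ys = dim (mov (refl_word ys))"
  using assms coxeter_word_mov[OF assms]
  by (simp add: coxeter_word_def root_basis_def dim_eq_card_independent distinct_card)

text \<open>The letters of a word for \<open>w\<close> serve as simple roots: every root of
  \<open>mov w\<close> is positive for them up to sign, hence hit by the rotation, and its sign does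
  not affect the reflection.\<close>

lemma quasi_coxeter_peel:
  assumes P: "root_sys P" and w: "quasi_coxeter P w" and a: "a \<in> P" "a \<in> mov w"
  shows "quasi_coxeter P (reflection_along a \<circ> w)"
proof -
  obtain ys where ys: "coxeter_word P ys" and weq: "w = refl_word ys"
    using w by (auto simp: quasi_coxeter_def)
  interpret based_root_sys "P \<inter> span (set ys)" "set ys"
    using ys P by unfold_locales (auto simp: coxeter_word_def intro: root_sys_Int)
  have aQ: "a \<in> P \<inter> span (set ys)" using a coxeter_word_mov[OF ys] weq by simp
  then have ne: "ys \<noteq> []" using P_nonzero by auto
  have "quasi_coxeter P (reflection_along b \<circ> w)" if "b \<in> pos" for b
    using exists_hit[of ys b] that ys coxeter_word_peel[OF P _ ne ys] weq by (auto simp: coxeter_word_def)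
  then show ?thesis using pos_neg[OF aQ] reflection_along_minus by metis
qed

subsection \<open>Absolute order\<close>

lemma reflection_along_scale: "k \<noteq> 0 \<Longrightarrow> reflection_along (k *\<^sub>R a) = reflection_along a"
  by (simp add: reflection_along_def fun_eq_iff)

lemma reflections_eq: "reflections G = reflection_along ` roots G"
proof
  show "reflections G \<subseteq> reflection_along ` roots G"
  proof
    fix t assume "t \<in> reflections G"
    then obtain a where a: "a \<noteq> 0" "t = reflection_along a" "t \<in> G"
      by (auto simp: reflections_def is_reflection_def)
    then have "reflection_along (inverse (norm a) *\<^sub>R a) = t" by (simp add: reflection_along_scale)
    then show "t \<in> reflection_along ` roots G"
      using a by (intro image_eqI[of _ _ "inverse (norm a) *\<^sub>R a"]) (auto simp: roots_def)
  qed
  show "reflection_along ` roots G \<subseteq> reflections G"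
  proof
    fix t assume "t \<in> reflection_along ` roots G"
    then obtain a where "norm a = 1" "t = reflection_along a" "t \<in> G" by (auto simp: roots_def)
    then show "t \<in> reflections G" by (auto simp: reflections_def is_reflection_def intro!: exI[of _ a])
  qed
qed

lemma words_image: "set ts \<subseteq> f ` A \<longleftrightarrow> (\<exists>ys. set ys \<subseteq> A \<and> ts = map f ys)"
proof
  assume "set ts \<subseteq> f ` A"
  then have "ts \<in> map f ` lists A" unfolding lists_image[symmetric] by auto
  then show "\<exists>ys. set ys \<subseteq> A \<and> ts = map f ys" by auto
next
  assume "\<exists>ys. set ys \<subseteq> A \<and> ts = map f ys"
  then show "set ts \<subseteq> f ` A" by (metis image_mono set_map)
qed

lemma word_length_le:
  "set ys \<subseteq> A \<Longrightarrow> word_length (reflection_along ` A) (refl_word ys) \<le> length ys"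
  unfolding word_length_def words_image
  by (rule Least_le) (use length_map[of reflection_along ys] in metis)

lemma word_length_attained:
  assumes "set xs \<subseteq> A"
  obtains ys where "set ys \<subseteq> A" "refl_word ys = refl_word xs"
    "length ys = word_length (reflection_along ` A) (refl_word xs)"
proof -
  let ?Q = "\<lambda>k. \<exists>ts. set ts \<subseteq> reflection_along ` A \<and> length ts = k \<and> word_prod ts = refl_word xs"
  have "?Q (length xs)" using assms by (intro exI[of _ "map reflection_along xs"]) auto
  then have "?Q (word_length (reflection_along ` A) (refl_word xs))"
    unfolding word_length_def by (rule LeastI)
  then show thesis using that by (auto simp: words_image)
qed

section \<open>Reflection length in the group\<close>

locale reflection_group =
  fixes W :: "('a::euclidean_space \<Rightarrow> 'a) set"
  assumes frg: "finite_reflection_group W"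
begin

lemma W_iff: "w \<in> W \<longleftrightarrow> (\<exists>ys. set ys \<subseteq> roots W \<and> w = refl_word ys)"
proof -
  have "W = {word_prod ts | ts. set ts \<subseteq> reflection_along ` roots W}"
    using frg unfolding finite_reflection_group_def reflections_eq by blast
  then have "w \<in> W \<longleftrightarrow> (\<exists>ts. set ts \<subseteq> reflection_along ` roots W \<and> w = word_prod ts)" by blast
  then show ?thesis unfolding words_image by blast
qed

lemma refl_word_W: "set ys \<subseteq> roots W \<Longrightarrow> refl_word ys \<in> W"
  using W_iff by blast

lemma W_orthogonal: "w \<in> W \<Longrightarrow> orthogonal_transformation w"
  using orthogonal_refl_word W_iff by metis

lemma root_sys_roots: "root_sys (roots W)"
proof -
  have "finite (roots W)"
  proof (rule finite_subset)
    show "roots W \<subseteq> (\<Union>t\<in>W. {a. norm a = 1 \<and> reflection_along a = t})" by (auto simp: roots_def)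
    have "finite {a :: 'a. norm a = 1 \<and> reflection_along a = t}" for t
    proof (cases "\<exists>b :: 'a. norm b = 1 \<and> reflection_along b = t")
      case True
      then obtain b :: 'a where b: "norm b = 1" "reflection_along b = t" by blast
      have "{a. norm a = 1 \<and> reflection_along a = t} \<subseteq> {b, - b}"
      proof
        fix a assume "a \<in> {a. norm a = 1 \<and> reflection_along a = t}"
        then show "a \<in> {b, - b}" using reflection_along_eqD[of a b] b by simp
      qed
      then show ?thesis by (rule finite_subset) simp
    next
      case False
      then have "{a :: 'a. norm a = 1 \<and> reflection_along a = t} = {}" by auto
      then show ?thesis by (simp only: finite.emptyI)
    qed
    then show "finite (\<Union>t\<in>W. {a. norm a = 1 \<and> reflection_along a = t})"
      using frg by (auto simp: finite_reflection_group_def)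
  qed
  moreover have "reflection_along a b \<in> roots W" if "a \<in> roots W" "b \<in> roots W" for a b
  proof -
    have "refl_word [a, b, a] \<in> W" using that by (intro refl_word_W) auto
    then have "reflection_along (reflection_along a b) \<in> W"
      by (simp add: reflection_along_reflection o_assoc)
    moreover have "norm (reflection_along a b) = 1"
      using that orthogonal_transformation_norm[OF orthogonal_reflection_along, of a b]
      by (simp add: roots_def)
    ultimately show ?thesis by (simp add: roots_def)
  qed
  ultimately show ?thesis by (auto simp: root_sys_def roots_def)
qed

lemma abs_length_le: "set ys \<subseteq> roots W \<Longrightarrow> abs_length W (refl_word ys) \<le> length ys"
  unfolding reflections_eq by (rule word_length_le)

lemma abs_length_attained:
  assumes "w \<in> W"
  obtains ys where "set ys \<subseteq> roots W" "w = refl_word ys" "length ys = abs_length W w"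
  using assms word_length_attained[of _ "roots W"] unfolding W_iff reflections_eq by metis

lemma dim_mov_le_abs_length: "w \<in> W \<Longrightarrow> dim (mov w) \<le> abs_length W w"
  by (metis abs_length_attained dim_mov_refl_word_le)

lemma abs_le_words:
  assumes "abs_le W v w"
  obtains ys zs where "set ys \<subseteq> roots W" "set zs \<subseteq> roots W" "v = refl_word ys" "w = refl_word (ys @ zs)"
    "length ys = abs_length W v" "length ys + length zs = abs_length W w"
proof -
  have v: "v \<in> W" "w \<in> W" and l: "abs_length W w = abs_length W v + abs_length W (inv v \<circ> w)"
    using assms by (auto simp: abs_le_def)
  obtain ys where ys: "set ys \<subseteq> roots W" "v = refl_word ys" "length ys = abs_length W v"
    using abs_length_attained v by blast
  obtain xs where xs: "set xs \<subseteq> roots W" "w = refl_word xs" using v W_iff by blast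
  have iw: "inv v \<circ> w = refl_word (rev ys @ xs)" by (simp add: ys xs inv_refl_word)
  then have "inv v \<circ> w \<in> W" using ys xs refl_word_W[of "rev ys @ xs"] by simp
  then obtain zs where zs: "set zs \<subseteq> roots W" "inv v \<circ> w = refl_word zs"
    "length zs = abs_length W (inv v \<circ> w)" using abs_length_attained by blast
  have "w = v \<circ> (inv v \<circ> w)" by (simp add: ys inv_refl_word fun_eq_iff)
  then have "w = refl_word (ys @ zs)" using zs ys by simp
  then show thesis using that ys zs l by auto
qed

text \<open>Length is subadditive and at most the number of letters, so a word of minimal total
  length leaves no slack in either factor.\<close>

lemma abs_le_if_words:
  assumes "set ys \<subseteq> roots W" "set zs \<subseteq> roots W"
    and l: "length ys + length zs = abs_length W (refl_word (ys @ zs))"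
  shows "abs_le W (refl_word ys) (refl_word (ys @ zs))" "abs_length W (refl_word ys) = length ys"
proof -
  let ?v = "refl_word ys" and ?w = "refl_word (ys @ zs)"
  have iw: "inv ?v \<circ> ?w = refl_word zs" by (simp add: inv_refl_word fun_eq_iff)
  have W: "?v \<in> W" "?w \<in> W" "refl_word zs \<in> W" by (rule refl_word_W, use assms in simp)+
  obtain ys' where ys': "set ys' \<subseteq> roots W" "?v = refl_word ys'" "length ys' = abs_length W ?v"
    using abs_length_attained W by blast
  obtain zs' where zs': "set zs' \<subseteq> roots W" "refl_word zs = refl_word zs'"
    "length zs' = abs_length W (refl_word zs)" using abs_length_attained W by blast
  have "?w = refl_word (ys' @ zs')" using ys' zs' by simp
  then have "abs_length W ?w \<le> abs_length W ?v + abs_length W (refl_word zs)"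
    using abs_length_le[of "ys' @ zs'"] ys' zs' by simp
  moreover have "abs_length W ?v \<le> length ys" "abs_length W (refl_word zs) \<le> length zs"
    using assms abs_length_le by auto
  ultimately have "abs_length W ?w = abs_length W ?v + abs_length W (refl_word zs)"
    and 2: "abs_length W ?v = length ys" using l by linarith+
  then show "abs_le W ?v ?w" using W by (simp only: abs_le_def iw simp_thms)
  show "abs_length W ?v = length ys" by (fact 2)
qed

lemma abs_le_trans:
  assumes "abs_le W u v" "abs_le W v w"
  shows "abs_le W u w"
proof -
  obtain ys zs where 1: "set ys \<subseteq> roots W" "set zs \<subseteq> roots W" "u = refl_word ys"
    "v = refl_word (ys @ zs)" "length ys + length zs = abs_length W v"
    using abs_le_words[OF assms(1)] by metis
  obtain ys' zs' where 2: "set ys' \<subseteq> roots W" "set zs' \<subseteq> roots W" "v = refl_word ys'"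
    "w = refl_word (ys' @ zs')" "length ys' = abs_length W v" "length ys' + length zs' = abs_length W w"
    using abs_le_words[OF assms(2)] by metis
  have w: "w = refl_word (ys @ (zs @ zs'))" using 1 2 by (simp add: o_assoc)
  show ?thesis unfolding 1(3) w
    by (rule abs_le_if_words) (use 1 2 w[symmetric] in \<open>auto simp del: map_append\<close>)
qed

subsection \<open>The interval below a quasi-Coxeter element\<close>

abbreviation "qc \<equiv> quasi_coxeter (roots W)"

lemma qc_W: "qc w \<Longrightarrow> w \<in> W"
  using refl_word_W by (auto simp: quasi_coxeter_def coxeter_word_def root_basis_def)

text \<open>The part of Carter's lemma that is needed: no word can have fewer letters than
  \<open>dim (mov w)\<close>, and a Coxeter word has exactly that many.\<close>

lemma qc_abs_length: "qc w \<Longrightarrow> abs_length W w = dim (mov w)"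
proof -
  assume w: "qc w"
  then obtain ys where ys: "coxeter_word (roots W) ys" "w = refl_word ys" by (auto simp: quasi_coxeter_def)
  then have "abs_length W w \<le> length ys"
    using abs_length_le by (auto simp: coxeter_word_def root_basis_def)
  then show ?thesis
    using coxeter_word_length[OF ys(1)] ys dim_mov_le_abs_length[OF qc_W[OF w]] by simp
qed

text \<open>The moved space contains the letters of a word for \<open>w\<close>, so it is spanned by
  roots, which \<open>B\<close> generates up to sign.\<close>

lemma qc_span_roots:
  assumes "qc w" "root_basis (roots W \<inter> mov w) B"
  shows "span B = mov w"
proof
  have "subspace (mov w)" using assms quasi_coxeter_orthogonal subspace_mov by blast
  then show "span B \<subseteq> mov w" using assms by (intro span_minimal) (auto simp: root_basis_def)
  obtain ys where ys: "coxeter_word (roots W) ys" "w = refl_word ys"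
    using assms(1) by (auto simp: quasi_coxeter_def)
  have "set ys \<subseteq> roots W \<inter> mov w"
    using ys coxeter_word_mov[OF ys(1)] by (auto simp: coxeter_word_def root_basis_def)
  moreover have "a \<in> span B" if "a \<in> roots W \<inter> mov w" for a
  proof -
    have "nonneg_comb B a \<or> nonneg_comb B (- a)" using assms(2) that by (simp add: root_basis_def)
    then show ?thesis using nonneg_comb_span span_neg by force
  qed
  ultimately have "set ys \<subseteq> span B" by blast
  then show "mov w \<subseteq> span B"
    using ys coxeter_word_mov[OF ys(1)] by (simp add: span_minimal)
qed

text \<open>Peeling acts on the left, while here the last letter \<open>z\<close> is to be removed.
  It is carried to the front as the root \<open>w z\<close>, which stays in \<open>mov w\<close>
  because \<open>w\<close> preserves its moved space.\<close>

lemma qc_prefix: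
  assumes "set ys \<subseteq> roots W" "set zs \<subseteq> roots W" "qc (refl_word (ys @ zs))"
    "length (ys @ zs) = dim (mov (refl_word (ys @ zs)))"
  shows "qc (refl_word ys) \<and> wall_le (refl_word ys) (refl_word (ys @ zs))"
  using assms
proof (induction zs rule: rev_induct)
  case Nil
  then show ?case by (simp add: wall_le_refl)
next
  case (snoc z zs)
  let ?w = "refl_word (ys @ zs @ [z])" and ?v = "refl_word (ys @ zs)"
  have ow: "orthogonal_transformation ?w" by (rule orthogonal_refl_word)
  have P: "set (ys @ zs @ [z]) \<subseteq> roots W" using snoc.prems by auto
  have wz: "?w z \<in> roots W" by (rule refl_word_root[OF root_sys_roots P]) (use P in auto)
  then have n: "norm (?w z) = 1" by (simp add: roots_def)
  have m: "mov ?w = span (set (ys @ zs @ [z]))" by (rule minimal_refl_word(3)) (fact snoc.prems(4))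
  have "z \<in> mov ?w" unfolding m by (rule span_base) simp
  then obtain x where "z = x - ?w x" by (auto simp: mov_def)
  then have "?w z = ?w x - ?w (?w x)" using linear_diff[OF linear_refl_word] by metis
  then have wm: "?w z \<in> mov ?w" by (auto simp: mov_def)
  have v: "?v = reflection_along (?w z) \<circ> ?w"
  proof
    fix x
    have "(reflection_along (?w z) \<circ> ?w) x = ?w (reflection_along z x)"
      using reflection_along_conj[OF ow, of z x] by simp
    then show "?v x = (reflection_along (?w z) \<circ> ?w) x" by simp
  qed
  have "qc ?v" unfolding v by (rule quasi_coxeter_peel[OF root_sys_roots _ wz wm]) (fact snoc.prems(3))
  moreover have le: "wall_le ?v ?w" unfolding v by (rule wall_le_peel[OF ow n wm])
  moreover have "dim (mov ?w) = Suc (dim (mov ?v))" unfolding v by (rule dim_mov_peel[OF ow n wm])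
  moreover have "length (ys @ zs @ [z]) = Suc (length (ys @ zs))" by simp
  ultimately have "length (ys @ zs) = dim (mov ?v)" using snoc.prems(4) by linarith
  then have "qc (refl_word ys) \<and> wall_le (refl_word ys) ?v"
    using snoc.prems(1,2) \<open>qc ?v\<close> by (intro snoc.IH) (assumption | simp)+
  then show ?case using le wall_le_trans by blast
qed

lemma abs_le_qc:
  assumes "qc w" "abs_le W v w"
  shows "qc v" "wall_le v w"
proof -
  obtain ys zs where *: "set ys \<subseteq> roots W" "set zs \<subseteq> roots W" "v = refl_word ys"
    "w = refl_word (ys @ zs)" "length ys + length zs = abs_length W w"
    using abs_le_words[OF assms(2)] by metis
  then have "qc v \<and> wall_le v w"
    using qc_prefix[of ys zs] qc_abs_length[OF assms(1)] assms(1) by simp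
  then show "qc v" "wall_le v w" by auto
qed

text \<open>Peel off the given roots from the left. Vanishing of \<open>wall w a b\<close> for later
  \<open>b\<close> says exactly that \<open>b\<close> stays in the moved space when \<open>a\<close>
  is removed.\<close>

lemma qc_complete_word:
  assumes "qc w" "set as \<subseteq> roots W \<inter> mov w" "sorted_wrt (\<lambda>a b. wall w a b = 0) as"
  shows "\<exists>zs. set zs \<subseteq> roots W \<and> w = refl_word (as @ zs) \<and> length (as @ zs) = dim (mov w)"
  using assms
proof (induction as arbitrary: w)
  case Nil
  then obtain ys where "coxeter_word (roots W) ys" "w = refl_word ys" by (auto simp: quasi_coxeter_def)
  then show ?case using coxeter_word_length
    by (intro exI[of _ ys]) (auto simp: coxeter_word_def root_basis_def)
next
  case (Cons a as)
  let ?v = "reflection_along a \<circ> w"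
  have ow: "orthogonal_transformation w" using Cons.prems quasi_coxeter_orthogonal by blast
  have a: "a \<in> roots W" "a \<in> mov w" "norm a = 1" using Cons.prems by (auto simp: roots_def)
  have v: "qc ?v" using quasi_coxeter_peel[OF root_sys_roots] Cons.prems(1) a by blast
  have as: "set as \<subseteq> mov ?v" unfolding mov_peel[OF ow a(3,2)] using Cons.prems by auto
  have "sorted_wrt (\<lambda>a b. wall ?v a b = 0) as"
  proof (rule sorted_wrt_mono_rel[of _ "\<lambda>a b. wall w a b = 0"])
    show "sorted_wrt (\<lambda>a b. wall w a b = 0) as" using Cons.prems by simp
    fix x y assume "x \<in> set as" "y \<in> set as" "wall w x y = 0"
    moreover have "wall ?v x y = wall w x y"
      using wall_le_peel[OF ow a(3,2)] as calculation unfolding wall_le_def by blast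
    ultimately show "wall ?v x y = 0" by simp
  qed
  moreover have "set as \<subseteq> roots W \<inter> mov ?v" using as Cons.prems(2) by auto
  ultimately obtain zs where
    zs: "set zs \<subseteq> roots W" "?v = refl_word (as @ zs)" "length (as @ zs) = dim (mov ?v)"
    using Cons.IH[OF v] by blast
  have "w = reflection_along a \<circ> ?v" by (simp add: fun_eq_iff)
  then have "w = refl_word ((a # as) @ zs)" unfolding zs(2) by simp
  moreover have "length ((a # as) @ zs) = dim (mov w)" using zs(3) dim_mov_peel[OF ow a(3,2)] by simp
  ultimately show ?case using zs(1) by blast
qed

lemma qc_triangular:
  assumes "qc w" "set as \<subseteq> roots W \<inter> mov w" "sorted_wrt (\<lambda>a b. wall w a b = 0) as"
  shows "abs_le W (refl_word as) w" "mov (refl_word as) = span (set as)" "independent (set as)" "distinct as"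
proof -
  obtain zs where zs: "set zs \<subseteq> roots W" "w = refl_word (as @ zs)" "length (as @ zs) = dim (mov w)"
    using qc_complete_word[OF assms] by blast
  show "abs_le W (refl_word as) w"
    unfolding zs(2)
    by (rule abs_le_if_words) (use zs assms qc_abs_length[OF assms(1)] in auto)
  have m: "distinct (as @ zs)" "independent (set (as @ zs))"
    using minimal_refl_word[of "as @ zs"] zs by auto
  then show "independent (set as)" "distinct as" using independent_mono by auto
  then show "mov (refl_word as) = span (set as)" by (intro mov_refl_word)
qed

end

subsection \<open>Strong exchange\<close>

text \<open>Reading from the right, the root turns negative at some letter; a simple reflection
  makes no positive root negative but its own.\<close>

lemma (in based_root_sys) exchange:
  assumes "set as \<subseteq> D" "a \<in> pos" "refl_word as a \<notin> pos"
  shows "\<exists>us b vs. as = us @ b # vs \<and> refl_word vs a = b"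
  using assms
proof (induction as)
  case (Cons s as)
  show ?case
  proof (cases "refl_word as a \<in> pos")
    case True
    then have "refl_word as a = s"
      using Cons.prems simple_reflection_pos[of s "refl_word as a"] by auto
    then show ?thesis by (intro exI[of _ "[]"]) auto
  next
    case False
    then obtain us b vs where "as = us @ b # vs \<and> refl_word vs a = b" using Cons by auto
    then show ?thesis by (intro exI[of _ "s # us"]) auto
  qed
qed simp

lemma exchange_word:
  assumes "refl_word vs a = b"
  shows "refl_word (us @ b # vs) \<circ> reflection_along a = refl_word (us @ vs)"
proof
  fix x
  have "refl_word vs (reflection_along a x) = reflection_along b (refl_word vs x)"
    using reflection_along_conj[OF orthogonal_refl_word, of vs a x] assms by simp
  then show "(refl_word (us @ b # vs) \<circ> reflection_along a) x = refl_word (us @ vs) x" by simp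
qed

lemma refl_word_diff_span: "refl_word ys x - x \<in> span (set ys)"
proof -
  have "x - refl_word ys x \<in> span (set ys)" using mov_refl_word_subset[of ys] by (auto simp: mov_def)
  then show ?thesis using span_neg by fastforce
qed

text \<open>A combination of the other simple roots leaves the \<open>b\<close>-coordinate equal to
  1.\<close>

lemma (in based_root_sys) pos_if_diff_span:
  assumes "a \<in> P" "b \<in> D" "C \<subseteq> D - {b}" "a - b \<in> span C"
  shows "a \<in> pos"
proof (rule pos_if_coord[OF assms(1,2)])
  have sp: "a - b \<in> span D" using assms span_mono[of C D] by auto
  have "representation D (a - b) = representation C (a - b)"
    using assms by (intro real_vector.representation_extend indep_D) auto
  then have "representation D (a - b) b = 0"
    using assms(3) real_vector.representation_ne_zero[of C "a - b" b] by auto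
  moreover have "representation D a b = representation D (a - b) b + representation D b b"
    using fun_cong[OF real_vector.representation_add[OF indep_D sp span_base[OF assms(2)]], of b]
    by simp
  ultimately show "representation D a b > 0"
    using assms indep_D by (simp add: real_vector.representation_basis)
qed

lemma (in based_root_sys) reflection_inj_pos: "inj_on reflection_along pos"
proof (rule inj_onI)
  fix a b assume "a \<in> pos" "b \<in> pos" "reflection_along a = reflection_along b"
  then show "a = b" using reflection_along_eqD[of a b] norm_P pos_P pos_not_neg by blast
qed

subsection \<open>Noncrossing partitions and simple systems\<close>

locale coxeter_setup = reflection_group W for W :: "('a::euclidean_space \<Rightarrow> 'a) set" +
  fixes D :: "'a set" and cword :: "'a list"
  assumes ss: "simple_system W D" and distinct_cword: "distinct cword" and set_cword: "set cword = D"
begin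

definition c :: "'a \<Rightarrow> 'a" where "c = refl_word cword"

sublocale based_root_sys "roots W" D
  using ss root_sys_roots by unfold_locales (auto simp: simple_system_iff_root_basis)

abbreviation "len \<equiv> coxeter_length D"

lemma orthogonal_c: "orthogonal_transformation c"
  unfolding c_def by (rule orthogonal_refl_word)

lemma mov_c: "mov c = span D"
  unfolding c_def using mov_refl_word distinct_cword set_cword indep_D by metis

lemma pos_mov_c: "pos \<subseteq> mov c"
  using P_span pos_P mov_c by blast

lemma roots_span_D: "roots W \<inter> span D = roots W"
  using P_span by blast

lemma qc_c: "qc c"
proof -
  have "coxeter_word (roots W) cword"
    using distinct_cword set_cword rb roots_span_D by (simp add: coxeter_word_def)
  then show ?thesis using c_def by (auto simp: quasi_coxeter_def)
qed

definition depth :: "'a \<Rightarrow> nat" where "depth a = (SOME m. hit m cword a)"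

lemma hit_depth: "a \<in> pos \<Longrightarrow> hit (depth a) cword a"
  unfolding depth_def using exists_hit[OF distinct_cword set_cword] by (rule someI_ex)

lemma depth_inj: "inj_on depth pos"
proof (rule inj_onI)
  fix a b assume "a \<in> pos" "b \<in> pos" "depth a = depth b"
  then show "a = b" using hit_depth[of a] hit_depth[of b] hit_inj[of "depth b" cword a b] by simp
qed

lemma wall_depth:
  "a \<in> pos \<Longrightarrow> b \<in> pos \<Longrightarrow> depth a < depth b \<Longrightarrow> 0 \<le> wall c a b"
  "a \<in> pos \<Longrightarrow> b \<in> pos \<Longrightarrow> depth a < depth b \<Longrightarrow> wall c b a \<le> 0"
  using wall_hit[OF distinct_cword set_cword _ _ hit_depth hit_depth] unfolding c_def by blast+

lemma wall_c_self: "a \<in> pos \<Longrightarrow> wall c a a = 1 / 2"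
  using wall_self[OF orthogonal_c] pos_mov_c norm_P pos_P by (simp add: subset_iff dot_square_norm)

text \<open>For \<open>U = mov w\<close> these are the positive roots of S(\<Gamma>(w)); see
  \<open>induced_eq\<close>.\<close>

definition base :: "'a set \<Rightarrow> 'a set" where
  "base U = (THE B. root_basis (roots W \<inter> U) B \<and> B \<subseteq> pos)"

lemma base_unique: "root_basis (roots W \<inter> U) B \<Longrightarrow> B \<subseteq> pos \<Longrightarrow> base U = B"
  unfolding base_def using pos_basis_unique by (intro the_equality) blast+

lemma base:
  assumes "subspace U"
  shows "root_basis (roots W \<inter> U) (base U)" "base U \<subseteq> pos"
  using exists_pos_basis[OF assms] base_unique by metis+

text \<open>The consequences of \<open>abs_le W w c\<close> on which the inductions run; both pass
  to peeled elements without counting letters.\<close>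

definition nc :: "('a \<Rightarrow> 'a) \<Rightarrow> bool" where "nc w \<longleftrightarrow> qc w \<and> wall_le w c"

lemma nc_orthogonal: "nc w \<Longrightarrow> orthogonal_transformation w"
  using quasi_coxeter_orthogonal by (auto simp: nc_def)

lemma nc_subspace: "nc w \<Longrightarrow> subspace (mov w)"
  using nc_orthogonal subspace_mov by blast

lemma NC_iff: "w \<in> NC W c \<longleftrightarrow> abs_le W w c"
  by (auto simp: NC_def abs_le_def)

lemma NC_nc: "w \<in> NC W c \<Longrightarrow> nc w"
  using abs_le_qc[OF qc_c] by (auto simp: nc_def NC_iff)

lemma nc_peel:
  assumes "nc w" "a \<in> pos" "a \<in> mov w"
  shows "nc (reflection_along a \<circ> w)"
    and "mov (reflection_along a \<circ> w) = {u \<in> mov w. wall c a u = 0}"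
proof -
  have a: "a \<in> roots W" "norm a = 1" using assms norm_P pos_P by auto
  have w: "orthogonal_transformation w" using assms nc_orthogonal by blast
  have "qc (reflection_along a \<circ> w)"
    using quasi_coxeter_peel[OF root_sys_roots] a assms by (auto simp: nc_def)
  then show "nc (reflection_along a \<circ> w)"
    using wall_le_peel[OF w a(2) assms(3)] wall_le_trans assms(1) by (auto simp: nc_def)
  have "wall w a u = wall c a u" if "u \<in> mov w" for u
    using that assms by (auto simp: nc_def wall_le_def)
  then show "mov (reflection_along a \<circ> w) = {u \<in> mov w. wall c a u = 0}"
    using mov_peel[OF w a(2) assms(3)] by auto
qed

lemma nc_span: "nc w \<Longrightarrow> root_basis (roots W \<inter> mov w) B \<Longrightarrow> span B = mov w"
  using qc_span_roots by (auto simp: nc_def)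

lemma nc_eqI:
  "nc v \<Longrightarrow> nc w \<Longrightarrow> mov v = mov w \<Longrightarrow> v = w"
  using wall_le_unique[OF _ _ orthogonal_c] nc_orthogonal by (auto simp: nc_def)

text \<open>The root \<open>b\<close> of least depth in \<open>mov w\<close> is simple, and splitting it off from \<open>w\<close> leaves an
  element whose simple system is obtained by deleting \<open>b\<close>.\<close>

lemma nc_step:
  assumes w: "nc w" and B: "root_basis (roots W \<inter> mov w) B" "B \<subseteq> pos" "B \<noteq> {}"
  obtains b where "b \<in> B" "\<And>a. a \<in> pos \<inter> mov w \<Longrightarrow> a \<noteq> b \<Longrightarrow> depth b < depth a"
    "\<And>a. a \<in> B \<Longrightarrow> a \<noteq> b \<Longrightarrow> wall c b a = 0"
    "nc (reflection_along b \<circ> w)"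
    "root_basis (roots W \<inter> mov (reflection_along b \<circ> w)) (B - {b})"
proof -
  have BM: "B \<subseteq> pos \<inter> mov w" and iB: "independent B" using B by (auto simp: root_basis_def)
  then have fB: "finite B" using fin_pos finite_subset by blast
  have Mc: "mov w \<subseteq> mov c" using w by (auto simp: nc_def wall_le_def)
  have comb: "nonneg_comb B a" if "a \<in> pos \<inter> mov w" for a
    using pos_basis_comb[OF B(1,2)] that pos_P by auto
  obtain e where "e \<in> pos \<inter> mov w" using B BM by blast
  from ex_has_least_nat[of "\<lambda>a. a \<in> pos \<inter> mov w", OF this, of depth]
  obtain b where b: "b \<in> pos" "b \<in> mov w" and le: "\<And>a. a \<in> pos \<inter> mov w \<Longrightarrow> depth b \<le> depth a"
    by blast
  have less: "depth b < depth a" if "a \<in> pos \<inter> mov w" "a \<noteq> b" for a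
    using le[OF that(1)] that b inj_onD[OF depth_inj, of a b] by force
  \<comment> \<open>If \<open>b\<close> were not simple, expanding its left occurrence in
    \<open>wall c b b\<close> over \<open>B\<close> would give only terms \<le> 0, since every
    member of \<open>B\<close> is deeper than \<open>b\<close>; but the value is 1/2.\<close>
  have bB: "b \<in> B"
  proof (rule ccontr)
    assume "b \<notin> B"
    obtain k where k: "\<forall>d\<in>B. 0 \<le> k d" "b = (\<Sum>d\<in>B. k d *\<^sub>R d)"
      using comb b by (auto simp: nonneg_comb_def)
    have "wall c b b = (\<Sum>d\<in>B. k d * wall c d b)"
      using wall_sum_left[OF orthogonal_c, of b B "\<lambda>d. d" k] k(2) BM Mc b by auto
    also have "\<dots> \<le> 0"
    proof (intro sum_nonpos mult_nonneg_nonpos)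
      fix d assume d: "d \<in> B"
      then show "0 \<le> k d" using k by blast
      have "d \<noteq> b" using d \<open>b \<notin> B\<close> by blast
      then show "wall c d b \<le> 0" using wall_depth(2) less[of d] d BM b by blast
    qed
    finally show False using wall_c_self b by simp
  qed
  let ?v = "reflection_along b \<circ> w"
  have v: "nc ?v" "mov ?v = {u \<in> mov w. wall c b u = 0}" using nc_peel[OF w b] by auto
  define C where "C = {a \<in> B. wall c b a = 0}"
  have CB: "C \<subseteq> B - {b}" using wall_c_self[OF b(1)] by (auto simp: C_def)
  have CM: "C \<subseteq> mov ?v" unfolding v(2) using BM by (auto simp: C_def)
  \<comment> \<open>Expand \<open>wall c b z = 0\<close> over \<open>B\<close>: all terms are
    nonnegative because \<open>b\<close> has least depth, so each vanishes and only members of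
    \<open>C\<close> occur in \<open>z\<close>.\<close>
  have span_pos: "z \<in> span C" if z: "z \<in> pos" "z \<in> mov ?v" for z
  proof -
    have "z \<in> pos \<inter> mov w" using z v by blast
    then obtain k where k: "\<forall>d\<in>B. 0 \<le> k d" "z = (\<Sum>d\<in>B. k d *\<^sub>R d)"
      using comb by (auto simp: nonneg_comb_def)
    have "(\<Sum>d\<in>B. k d * wall c b d) = 0"
      using z v k(2) by (simp add: wall_sum_right wall_scale_right)
    moreover have "0 \<le> k d * wall c b d" if d: "d \<in> B" for d
    proof (cases "d = b")
      case False
      then have "0 \<le> wall c b d" using d wall_depth(1)[of b d] less[of d] BM b by blast
      then show ?thesis using k(1) d by simp
    qed (use d k wall_c_self[OF b(1)] in auto)
    ultimately have kz: "k d * wall c b d = 0" if "d \<in> B" for d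
      using sum_nonneg_0[OF fB, of "\<lambda>d. k d * wall c b d"] that by blast
    have "k d *\<^sub>R d \<in> span C" if "d \<in> B" for d
      using that kz[OF that] by (cases "wall c b d = 0") (auto simp: C_def intro: span_scale span_base span_zero)
    then show ?thesis unfolding k(2) by (intro span_sum)
  qed
  have rspan: "z \<in> span C" if "z \<in> roots W \<inter> mov ?v" for z
  proof -
    have "- z \<in> mov ?v" using that subspace_neg[OF nc_subspace[OF v(1)]] by blast
    then show ?thesis using pos_neg[of z] that span_pos[of z] span_pos[of "- z"] span_neg[of "- z" C] by auto
  qed
  have "mov ?v \<subseteq> span C"
  proof -
    obtain E where E: "root_basis (roots W \<inter> mov ?v) E"
      using exists_pos_basis[OF nc_subspace[OF v(1)]] by blast
    then have "E \<subseteq> span C" using rspan by (auto simp: root_basis_def)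
    then show ?thesis using nc_span[OF v(1) E] span_minimal[of E "span C"] by simp
  qed
  then have vC: "mov ?v = span C"
    using CM nc_subspace[OF v(1)] span_minimal by blast
  \<comment> \<open>Peeling lowers the dimension by just one, so \<open>C\<close> misses no simple
    root besides \<open>b\<close>.\<close>
  have "dim (mov w) = Suc (dim (mov ?v))"
    using dim_mov_peel[OF nc_orthogonal[OF w] _ b(2)] norm_P pos_P b by blast
  moreover have "dim (mov w) = card B"
    using nc_span[OF w B(1)] iB by (metis dim_span dim_eq_card_independent)
  moreover have "dim (mov ?v) = card C"
    using vC iB CB independent_mono[of B C] by (simp add: dim_eq_card_independent subset_Diff_insert)
  ultimately have "card C = card (B - {b})" using bB fB by simp
  then have C: "C = B - {b}" using CB fB by (intro card_subset_eq) auto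
  have "roots W \<inter> mov w \<inter> span C = roots W \<inter> mov ?v" using v vC by auto
  then have "root_basis (roots W \<inter> mov ?v) (B - {b})"
    using root_basis_face[OF B(1), of C] CB C by auto
  moreover have "wall c b a = 0" if "a \<in> B" "a \<noteq> b" for a using that C by (auto simp: C_def)
  ultimately show thesis using that bB less v by blast
qed

lemma nc_basis_wall:
  assumes "nc w" "root_basis (roots W \<inter> mov w) B" "B \<subseteq> pos" "a \<in> B" "b \<in> B" "depth a < depth b"
  shows "wall c a b = 0"
  using assms
proof (induction "card B" arbitrary: w B)
  case 0
  then show ?case using fin_pos finite_subset by (metis card_0_eq empty_iff)
next
  case (Suc n)
  have fB: "finite B" using Suc.prems fin_pos finite_subset by blast
  have BM: "B \<subseteq> pos \<inter> mov w" using Suc.prems by (auto simp: root_basis_def)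
  obtain d where d: "d \<in> B" "\<And>a. a \<in> pos \<inter> mov w \<Longrightarrow> a \<noteq> d \<Longrightarrow> depth d < depth a"
    "\<And>a. a \<in> B \<Longrightarrow> a \<noteq> d \<Longrightarrow> wall c d a = 0"
    "nc (reflection_along d \<circ> w)"
    "root_basis (roots W \<inter> mov (reflection_along d \<circ> w)) (B - {d})"
    using nc_step[OF Suc.prems(1-3)] Suc.prems(4) by blast
  show ?case
  proof (cases "a = d")
    case True
    then show ?thesis using d(3)[of b] Suc.prems by auto
  next
    case False
    moreover have "b \<noteq> d" using d(2)[of a] False Suc.prems BM by fastforce
    moreover have "n = card (B - {d})" using Suc.hyps(2) d(1) fB by simp
    ultimately show ?thesis
      using Suc.hyps(1)[of "B - {d}" "reflection_along d \<circ> w"] d(4,5) Suc.prems by blast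
  qed
qed

text \<open>It suffices that \<open>X\<close> contains the root \<open>b\<close> of least depth in
  \<open>mov w\<close>, for then \<open>b\<close> can be split off on both sides. Otherwise write
  \<open>b = p - q\<close> by the signs of its coefficients over \<open>X\<close>. The values of
  \<open>wall c\<close> at \<open>p, b\<close> and at \<open>p, q\<close> are \<le> 0, hence so is
  the value at \<open>p, p\<close>; thus \<open>p = 0\<close> and \<open>- b = q\<close> lies in the
  positive cone.\<close>

lemma nc_face_eq_basis:
  assumes "nc w" "root_basis (roots W \<inter> mov w) B" "B \<subseteq> pos"
    and "X \<subseteq> pos \<inter> mov w" "card X = card B"
    and "\<And>a b. a \<in> X \<Longrightarrow> b \<in> X \<Longrightarrow> a \<noteq> b \<Longrightarrow> a \<bullet> b \<le> 0"
    and "\<And>a b. a \<in> X \<Longrightarrow> b \<in> X \<Longrightarrow> depth a < depth b \<Longrightarrow> wall c a b = 0"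
  shows "X = B"
  using assms
proof (induction "card B" arbitrary: w B X)
  case 0
  then have "finite B" "finite X" using fin_pos finite_subset by blast+
  then show ?case using 0 by auto
next
  case (Suc n)
  have fB: "finite B" and fX: "finite X" using Suc.prems fin_pos finite_subset by blast+
  have BM: "B \<subseteq> pos \<inter> mov w" and iB: "independent B" using Suc.prems by (auto simp: root_basis_def)
  have Mc: "mov w \<subseteq> mov c" using Suc.prems by (auto simp: nc_def wall_le_def)
  have Xc: "x \<in> mov c" if "x \<in> X" for x using that Suc.prems Mc by blast
  obtain b where b: "b \<in> B" "\<And>a. a \<in> pos \<inter> mov w \<Longrightarrow> a \<noteq> b \<Longrightarrow> depth b < depth a"
    "\<And>a. a \<in> B \<Longrightarrow> a \<noteq> b \<Longrightarrow> wall c b a = 0"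
    "nc (reflection_along b \<circ> w)"
    "root_basis (roots W \<inter> mov (reflection_along b \<circ> w)) (B - {b})"
    using nc_step[OF Suc.prems(1-3)] Suc.hyps(2) by force
  have bp: "b \<in> pos" "b \<in> mov w" using b(1) BM by auto
  have iX: "independent X" using Suc.prems obtuse_pos_independent by blast
  have "mov w \<subseteq> span X"
  proof (rule card_ge_dim_independent[OF _ iX])
    have "dim (mov w) = card B"
      using nc_span[OF Suc.prems(1,2)] iB by (metis dim_span dim_eq_card_independent)
    then show "dim (mov w) \<le> card X" using Suc.prems by simp
  qed (use Suc.prems in auto)
  then have bX: "b \<in> span X" using bp by blast
  \<comment> \<open>One of the two values vanishes by the order of the depths, so the other one is
    \<open>x \<bullet> y\<close>.\<close>
  have off: "wall c x y \<le> 0" if xy: "x \<in> X" "y \<in> X" "x \<noteq> y" for x y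
  proof (cases "depth x < depth y")
    case True
    then show ?thesis using Suc.prems(7) xy by simp
  next
    case False
    moreover have "depth x \<noteq> depth y" using inj_onD[OF depth_inj, of x y] xy Suc.prems by blast
    ultimately have "wall c y x = 0" using Suc.prems(7) xy by simp
    then show ?thesis
      using wall_swap[OF orthogonal_c, of x y] Suc.prems(6)[of x y] xy Xc by simp
  qed
  have bX': "b \<in> X"
  proof (rule ccontr)
    assume nb: "b \<notin> X"
    define k where "k = representation X b"
    have kb: "b = (\<Sum>x\<in>X. k x *\<^sub>R x)" unfolding k_def using representation_expand[OF iX bX] by simp
    define p where "p = (\<Sum>x\<in>X. max (k x) 0 *\<^sub>R x)"
    define q where "q = (\<Sum>x\<in>X. max (- k x) 0 *\<^sub>R x)"
    have bpq: "b = p - q"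
      unfolding kb p_def q_def sum_subtractf[symmetric]
      by (intro sum.cong refl) (auto simp: max_def)
    have pc: "p \<in> mov c" unfolding p_def
      using Xc subspace_mov[OF orthogonal_c] by (intro subspace_sum) (auto intro: subspace_scale)
    have "wall c p b = (\<Sum>x\<in>X. max (k x) 0 * wall c x b)"
      unfolding p_def using bp Mc Xc by (intro wall_sum_left[OF orthogonal_c]) auto
    also have "\<dots> \<le> 0"
    proof (intro sum_nonpos mult_nonneg_nonpos)
      fix x assume x: "x \<in> X"
      then have "depth b < depth x" using b(2)[of x] nb Suc.prems(4) by blast
      then show "wall c x b \<le> 0" using wall_depth(2)[of b x] x Suc.prems bp by blast
    qed auto
    finally have 1: "wall c p b \<le> 0" .
    have "wall c p q = (\<Sum>y\<in>X. max (- k y) 0 * wall c p y)"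
      unfolding q_def by (simp add: wall_sum_right wall_scale_right)
    also have "\<dots> = (\<Sum>y\<in>X. max (- k y) 0 * (\<Sum>x\<in>X. max (k x) 0 * wall c x y))"
      unfolding p_def using Xc by (intro sum.cong refl arg_cong2[where f = "(*)"] wall_sum_left[OF orthogonal_c])
    also have "\<dots> = (\<Sum>y\<in>X. \<Sum>x\<in>X. max (- k y) 0 * (max (k x) 0 * wall c x y))"
      by (simp add: sum_distrib_left)
    \<comment> \<open>No root of \<open>X\<close> occurs in both \<open>p\<close> and
      \<open>q\<close>, so only off-diagonal values contribute.\<close>
    also have "\<dots> \<le> 0"
    proof (intro sum_nonpos)
      fix x y assume "y \<in> X" "x \<in> X"
      then show "max (- k y) 0 * (max (k x) 0 * wall c x y) \<le> 0"
        using off[of x y] by (cases "x = y") (auto simp: max_def mult_nonneg_nonpos)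
    qed
    finally have "wall c p p \<le> 0" using 1 by (simp add: bpq wall_diff_right)
    then have "p = 0" using wall_self[OF orthogonal_c pc] by (metis divide_nonneg_pos inner_eq_zero_iff inner_ge_zero
            divide_eq_0_iff order_antisym zero_less_numeral zero_neq_numeral)
    then have "- b = q" using bpq by simp
    moreover have "nonneg_comb D q"
      unfolding q_def using Suc.prems(4) pos_comb by (intro nonneg_comb_sum nonneg_comb_scale) auto
    ultimately have "b = 0" using nonneg_comb_antisym[OF indep_D pos_comb[OF bp(1)]] by simp
    then show False using P_nonzero pos_P bp by blast
  qed
  have "X - {b} = B - {b}"
  proof (rule Suc.hyps(1)[OF _ b(4,5)])
    show "n = card (B - {b})" "card (X - {b}) = card (B - {b})"
      using Suc.hyps(2) Suc.prems(5) b(1) fB fX bX' by auto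
    have "wall c b x = 0" if "x \<in> X - {b}" for x
      using that Suc.prems(7)[of b x] b(2)[of x] Suc.prems(4) bX' by blast
    then show "X - {b} \<subseteq> pos \<inter> mov (reflection_along b \<circ> w)"
      unfolding nc_peel(2)[OF Suc.prems(1) bp] using Suc.prems(4) by blast
  qed (use Suc.prems in auto)
  then show ?case using b(1) bX' by blast
qed

section \<open>Faces and noncrossing elements\<close>

lemma exists_sorted:
  assumes "A \<subseteq> pos"
  obtains as where "set as = A" "sorted_wrt (\<lambda>a b. depth a < depth b) as"
proof -
  have "finite A" using assms fin_pos finite_subset by blast
  then obtain xs where xs: "set xs = A" "distinct xs" using finite_distinct_list by blast
  let ?as = "sort_key depth xs"
  have "inj_on depth (set ?as)" using xs assms depth_inj inj_on_subset by auto
  then have "distinct (map depth ?as)" using xs by (simp add: distinct_map)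
  then have "sorted_wrt (<) (map depth ?as)" by (simp add: strict_sorted_iff)
  then show thesis using that[of ?as] xs by (simp add: sorted_wrt_map)
qed

lemma sorted_depth_distinct: "sorted_wrt (\<lambda>a b. depth a < depth b) as \<Longrightarrow> distinct as"
  by (induction as) auto

definition face :: "'a set \<Rightarrow> bool" where
  "face A \<longleftrightarrow> A \<subseteq> pos \<and>
    (\<forall>a\<in>A. \<forall>b\<in>A. a \<noteq> b \<longrightarrow> (wall c a b = 0 \<or> wall c b a = 0) \<and> a \<bullet> b \<le> 0)"

text \<open>If \<open>wall c b a = 0\<close>, then \<open>wall c a b = a \<bullet> b \<le> 0\<close>, while the order of the depths makes
  \<open>wall c a b\<close> nonnegative.\<close>

lemma face_wall:
  assumes "face A" "a \<in> A" "b \<in> A" "depth a < depth b"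
  shows "wall c a b = 0"
proof -
  have ab: "a \<in> pos" "b \<in> pos" "a \<noteq> b" using assms by (auto simp: face_def)
  then have "wall c a b = 0 \<or> wall c b a = 0" "a \<bullet> b \<le> 0" using assms by (auto simp: face_def)
  moreover have "wall c a b = a \<bullet> b - wall c b a"
    using wall_swap[OF orthogonal_c] pos_mov_c ab by blast
  ultimately show ?thesis using wall_depth(1)[OF ab(1,2) assms(4)] by auto
qed

lemma sorted_word_NC:
  assumes "set as \<subseteq> pos" "sorted_wrt (\<lambda>a b. depth a < depth b) as"
    "\<And>a b. a \<in> set as \<Longrightarrow> b \<in> set as \<Longrightarrow> depth a < depth b \<Longrightarrow> wall c a b = 0"
  shows "refl_word as \<in> NC W c" "mov (refl_word as) = span (set as)" "independent (set as)"
proof -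
  have 1: "set as \<subseteq> roots W \<inter> mov c" using assms pos_P pos_mov_c by blast
  have 2: "sorted_wrt (\<lambda>a b. wall c a b = 0) as"
    by (rule sorted_wrt_mono_rel[OF _ assms(2)]) (use assms(3) in blast)
  show "refl_word as \<in> NC W c" "mov (refl_word as) = span (set as)" "independent (set as)"
    using qc_triangular[OF qc_c 1 2] by (auto simp: NC_iff)
qed

lemma NC_base:
  assumes "w \<in> NC W c"
  shows "root_basis (roots W \<inter> mov w) (base (mov w))" "base (mov w) \<subseteq> pos"
    "span (base (mov w)) = mov w" "abs_length W w = card (base (mov w))"
proof -
  have nc: "nc w" using NC_nc assms by blast
  show rb: "root_basis (roots W \<inter> mov w) (base (mov w))" and "base (mov w) \<subseteq> pos"
    using base nc_subspace[OF nc] by auto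
  show sp: "span (base (mov w)) = mov w" by (rule nc_span[OF nc rb])
  have "dim (mov w) = card (base (mov w))"
    using sp rb by (metis dim_span dim_eq_card_independent root_basis_def)
  then show "abs_length W w = card (base (mov w))" using qc_abs_length nc by (simp add: nc_def)
qed

lemma face_realized:
  assumes "face A"
  obtains w where "w \<in> NC W c" "base (mov w) = A"
proof -
  have Ap: "A \<subseteq> pos" using assms by (simp add: face_def)
  obtain as where as: "set as = A" "sorted_wrt (\<lambda>a b. depth a < depth b) as"
    using exists_sorted[OF Ap] by blast
  let ?w = "refl_word as"
  have w: "?w \<in> NC W c" "mov ?w = span A" "independent A"
    using sorted_word_NC[of as] as Ap face_wall[OF assms] by auto
  have "A = base (mov ?w)"
  proof (rule nc_face_eq_basis[OF NC_nc[OF w(1)] NC_base(1,2)[OF w(1)]])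
    show "A \<subseteq> pos \<inter> mov ?w" using Ap w(2) span_superset by blast
    have "card A = dim (mov ?w)" using w by (simp add: dim_eq_card_independent)
    then show "card A = card (base (mov ?w))"
      using NC_base(4)[OF w(1)] qc_abs_length NC_nc[OF w(1)] by (simp add: nc_def)
    show "a \<bullet> b \<le> 0" if "a \<in> A" "b \<in> A" "a \<noteq> b" for a b using assms that by (simp add: face_def)
  qed (use face_wall[OF assms] in blast)
  then show thesis using that w(1) by blast
qed

lemma base_wall:
  "w \<in> NC W c \<Longrightarrow> a \<in> base (mov w) \<Longrightarrow> b \<in> base (mov w) \<Longrightarrow> depth a < depth b \<Longrightarrow> wall c a b = 0"
  using nc_basis_wall[OF NC_nc NC_base(1,2)] by blast

lemma base_root_sys:
  assumes "w \<in> NC W c"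
  shows "based_root_sys (roots W \<inter> mov w) (base (mov w))"
  using NC_base(1)[OF assms] root_sys_Int[OF root_sys_roots nc_subspace[OF NC_nc[OF assms]]]
  by unfold_locales

lemma base_face:
  assumes "w \<in> NC W c"
  shows "face (base (mov w))"
  unfolding face_def
proof (intro conjI ballI impI)
  show "base (mov w) \<subseteq> pos" using NC_base[OF assms] by blast
  fix a b assume ab: "a \<in> base (mov w)" "b \<in> base (mov w)" "a \<noteq> b"
  then have "depth a \<noteq> depth b"
    using inj_onD[OF depth_inj, of a b] NC_base(2)[OF assms] by blast
  then show "wall c a b = 0 \<or> wall c b a = 0"
    using base_wall[OF assms] ab by (metis linorder_neqE_nat)
  show "a \<bullet> b \<le> 0" using based_root_sys.basis_obtuse[OF base_root_sys[OF assms] ab] .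
qed

text \<open>The word gives an element below \<open>c\<close> that moves the same space as
  \<open>w\<close>, and the moved space determines the element.\<close>

lemma base_word:
  assumes "w \<in> NC W c" "set as = base (mov w)" "sorted_wrt (\<lambda>a b. depth a < depth b) as"
  shows "w = refl_word as"
proof (rule nc_eqI)
  show "nc w" using NC_nc assms by blast
  have as: "refl_word as \<in> NC W c" "mov (refl_word as) = span (set as)"
    using sorted_word_NC[of as] assms NC_base(2)[OF assms(1)] base_wall by auto
  show "nc (refl_word as)" using as NC_nc by blast
  show "mov w = mov (refl_word as)" using as assms NC_base by simp
qed

lemma base_inj:
  assumes "v \<in> NC W c" "w \<in> NC W c" "base (mov v) = base (mov w)"
  shows "v = w"
  using nc_eqI[OF NC_nc NC_nc] assms NC_base(3) by metis

lemma face_subset: "face A \<Longrightarrow> B \<subseteq> A \<Longrightarrow> face B"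
  unfolding face_def by blast

subsection \<open>Coxeter length\<close>

text \<open>A reflection is a word in simple reflections because its positive root is hit by
  rotating \<open>cword\<close>.\<close>

lemma simple_word:
  assumes "w \<in> W"
  obtains as where "set as \<subseteq> D" "w = refl_word as"
proof -
  have root: "\<exists>zs. set zs \<subseteq> D \<and> reflection_along a = refl_word zs"
    if a: "a \<in> roots W" for a
  proof -
    obtain b where b: "b \<in> pos" "reflection_along a = reflection_along b"
      using pos_neg[OF a] reflection_along_minus by metis
    have "D \<noteq> {}" using P_span[OF a] P_nonzero[OF a] by auto
    then have "cword \<noteq> []" using set_cword by auto
    then show ?thesis using hit_reflection_word[OF hit_depth[OF b(1)]] set_cword b(2) by auto
  qed
  obtain ys where "set ys \<subseteq> roots W" "w = refl_word ys" using assms W_iff by blast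
  moreover have "set ys \<subseteq> roots W \<Longrightarrow> \<exists>as. set as \<subseteq> D \<and> refl_word ys = refl_word as"
  proof (induction ys)
    case Nil
    show ?case by (intro exI[of _ "[]"]) simp
  next
    case (Cons a ys)
    then obtain zs as where "set zs \<subseteq> D" "reflection_along a = refl_word zs"
      "set as \<subseteq> D" "refl_word ys = refl_word as" using root[of a] by auto
    then show ?case by (intro exI[of _ "zs @ as"]) simp
  qed
  ultimately show thesis using that by metis
qed

lemma reflection_W: "a \<in> roots W \<Longrightarrow> w \<in> W \<Longrightarrow> w \<circ> reflection_along a \<in> W"
proof -
  assume a: "a \<in> roots W" and "w \<in> W"
  then obtain ys where "set ys \<subseteq> roots W" "w = refl_word ys" using W_iff by blast
  then show "w \<circ> reflection_along a \<in> W" using refl_word_W[of "ys @ [a]"] a by simp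
qed

lemma len_decreases:
  assumes "w \<in> W" "a \<in> pos" "w a \<notin> pos"
  shows "len (w \<circ> reflection_along a) < len w"
proof -
  obtain xs where "set xs \<subseteq> D" "w = refl_word xs" using simple_word assms by blast
  then obtain as where as: "set as \<subseteq> D" "w = refl_word as" "length as = len w"
    using word_length_attained[of xs D] unfolding simple_reflections_def by metis
  obtain us b vs where ubv: "as = us @ b # vs" "refl_word vs a = b"
    using exchange[of as a] as assms by blast
  have "w \<circ> reflection_along a = refl_word (us @ vs)"
    unfolding as(2) ubv(1) by (rule exchange_word[OF ubv(2)])
  moreover have "len (refl_word (us @ vs)) \<le> length (us @ vs)"
    unfolding simple_reflections_def by (rule word_length_le) (use as ubv in auto)
  ultimately show ?thesis using as ubv by simp
qed

text \<open>If \<open>w a\<close> is positive, then \<open>w \<circ> reflection_along a\<close>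
  makes \<open>a\<close> negative, and \<open>len_decreases\<close> gives the reverse
  inequality.\<close>

lemma len_reflection_iff:
  assumes "w \<in> W" "a \<in> pos"
  shows "len (w \<circ> reflection_along a) < len w \<longleftrightarrow> w a \<notin> pos"
proof
  assume less: "len (w \<circ> reflection_along a) < len w"
  show "w a \<notin> pos"
  proof
    assume "w a \<in> pos"
    let ?v = "w \<circ> reflection_along a"
    have "?v a = - w a"
      using linear_neg[OF orthogonal_transformation_linear[OF W_orthogonal[OF assms(1)]]] by simp
    then have "?v a \<notin> pos" using \<open>w a \<in> pos\<close> pos_not_neg by simp
    then have "len (?v \<circ> reflection_along a) < len ?v"
      using len_decreases[of ?v a] reflection_W pos_P assms by blast
    moreover have "?v \<circ> reflection_along a = w" by (simp add: fun_eq_iff)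
    ultimately show False using less by simp
  qed
qed (use len_decreases assms in blast)

subsection \<open>Covering relations\<close>

text \<open>Deleting \<open>b\<close> from the sorted word \<open>us @ b # vs\<close> is right
  multiplication by the reflection in \<open>a\<close>, the image of \<open>b\<close> under the
  inverse of \<open>vs\<close>. Both \<open>a\<close> and the image of \<open>b\<close> under
  \<open>us\<close> have \<open>b\<close>-coordinate 1 and are positive, while \<open>w\<close>
  sends \<open>a\<close> to the negative of the latter. Hence the length drops.\<close>

lemma remove_base:
  assumes v: "v \<in> NC W c" and w: "w \<in> NC W c" and b: "b \<in> base (mov w)"
    and eq: "base (mov v) = base (mov w) - {b}"
  shows "abs_cover W v w \<and> len v < len w"
proof -
  let ?B = "base (mov w)"
  interpret B: based_root_sys "roots W \<inter> mov w" ?B by (rule base_root_sys[OF w])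
  obtain as where as: "set as = ?B" "sorted_wrt (\<lambda>a b. depth a < depth b) as"
    using exists_sorted NC_base(2)[OF w] by blast
  have das: "distinct as" by (rule sorted_depth_distinct[OF as(2)])
  obtain us vs where ubv: "as = us @ b # vs" using b as by (metis split_list)
  have w_eq: "w = refl_word as" by (rule base_word[OF w as])
  have ub: "set us \<subseteq> ?B - {b}" "set vs \<subseteq> ?B - {b}" using das as ubv by auto
  have v_eq: "v = refl_word (us @ vs)"
    by (rule base_word[OF v]) (use as das ubv eq in \<open>auto simp: sorted_wrt_append\<close>)
  have PB: "?B \<subseteq> roots W" using NC_base[OF w] pos_P by blast
  define a where "a = refl_word (rev vs) b"
  have va: "refl_word vs a = b" by (simp add: a_def)
  have v_w: "w \<circ> reflection_along a = v" unfolding w_eq v_eq ubv by (rule exchange_word[OF va])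
  have bB: "b \<in> roots W \<inter> mov w" using B.D_sub b by blast
  have aP: "a \<in> roots W \<inter> mov w"
    unfolding a_def by (rule refl_word_root[OF B.rs]) (use ub B.D_sub bB in auto)
  have "a \<in> B.pos"
    by (rule B.pos_if_diff_span[OF aP b, of "set vs"])
      (use ub refl_word_diff_span[of "rev vs" b] in \<open>auto simp: a_def\<close>)
  moreover have Bpos: "x \<in> pos" if "x \<in> B.pos" for x
  proof -
    have "nonneg_comb D d" if "d \<in> ?B" for d using that NC_base(2)[OF w] pos_comb by blast
    then have "nonneg_comb D x" using nonneg_comb_trans B.pos_comb[OF that] by blast
    then show ?thesis using B.pos_P[OF that] by (simp add: pos_def)
  qed
  ultimately have ap: "a \<in> pos" by blast
  have wa: "w a = - refl_word us b"
    unfolding w_eq ubv using va linear_neg[OF linear_refl_word] by simp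
  have "refl_word us b \<in> roots W \<inter> mov w"
    by (rule refl_word_root[OF B.rs]) (use ub B.D_sub bB in auto)
  then have "refl_word us b \<in> B.pos"
    using B.pos_if_diff_span[OF _ b ub(1)] refl_word_diff_span by blast
  then have "w a \<notin> pos" using Bpos pos_not_neg wa by simp
  moreover have wW: "w \<in> W" using w by (simp add: NC_def)
  ultimately have 1: "len v < len w" using len_decreases[OF wW ap] v_w by simp
  have "w = v \<circ> reflection_along a" unfolding v_w[symmetric] by (simp add: fun_eq_iff)
  then have w_word: "w = refl_word ((us @ vs) @ [a])" unfolding v_eq by (simp add: o_assoc)
  have cB: "card ?B = length as" using das as by (metis distinct_card)
  have len_w: "abs_length W w = length as" and len_v: "abs_length W v = length (us @ vs)"
    using NC_base(4)[OF w] NC_base(4)[OF v] cB eq b ubv B.fin_D by auto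
  have "abs_le W (refl_word (us @ vs)) (refl_word ((us @ vs) @ [a]))"
    by (rule abs_le_if_words(1))
      (use len_w w_word ubv ub PB aP in \<open>auto simp del: map_append word_prod_append\<close>)
  then have "abs_le W v w" using v_eq w_word by simp
  then show ?thesis using 1 len_w len_v ubv by (simp add: abs_cover_def)
qed

text \<open>A cover is \<open>v = w \<circ> reflection_along a\<close> with \<open>a\<close>
  positive in \<open>mov w\<close>, and the drop in length says that \<open>w a\<close> is negative.
  The sorted word of \<open>w\<close> uses only simple roots of the subsystem in
  \<open>mov w\<close>, so exchange inside this subsystem deletes one of its letters.\<close>

lemma cover_base:
  assumes v: "v \<in> NC W c" and w: "w \<in> NC W c" and cov: "abs_cover W v w" and len: "len v < len w"
  obtains b where "b \<in> base (mov w)" "base (mov v) = base (mov w) - {b}"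
proof -
  let ?B = "base (mov w)"
  interpret B: based_root_sys "roots W \<inter> mov w" ?B by (rule base_root_sys[OF w])
  have wW: "w \<in> W" using w by (simp add: NC_def)
  obtain ys zs where yz: "set ys \<subseteq> roots W" "set zs \<subseteq> roots W" "v = refl_word ys"
    "w = refl_word (ys @ zs)" "length ys = abs_length W v" "length ys + length zs = abs_length W w"
    using abs_le_words cov unfolding abs_cover_def by metis
  then have "length zs = 1" using cov by (simp add: abs_cover_def)
  then obtain z where z: "zs = [z]" by (auto simp: length_Suc_conv)
  have "abs_length W w = dim (mov w)" using qc_abs_length NC_nc[OF w] by (simp add: nc_def)
  then have "mov w = span (set (ys @ zs))"
    using minimal_refl_word(3)[of "ys @ zs"] yz by simp
  then have zm: "z \<in> mov w" using z by (simp add: span_base)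
  have zr: "z \<in> roots W" using yz z by simp
  obtain a where a: "a \<in> pos" "a \<in> mov w" "reflection_along a = reflection_along z"
    using pos_neg[OF zr] zm reflection_along_minus subspace_neg[OF nc_subspace[OF NC_nc[OF w]]] by metis
  have v_w: "v = w \<circ> reflection_along a" unfolding a(3) using yz z by (simp add: fun_eq_iff)
  then have wa: "w a \<notin> pos" using len len_reflection_iff[OF wW a(1)] by simp
  obtain as where as: "set as = ?B" "sorted_wrt (\<lambda>a b. depth a < depth b) as"
    using exists_sorted NC_base(2)[OF w] by blast
  have das: "distinct as" by (rule sorted_depth_distinct[OF as(2)])
  have w_eq: "w = refl_word as" by (rule base_word[OF w as])
  have aP: "a \<in> roots W \<inter> mov w" using a pos_P by blast
  have aB: "a \<in> B.pos"
    using pos_basis_comb[OF NC_base(1,2)[OF w] _ aP a(1)] aP by (simp add: B.pos_def)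
  have "refl_word as a \<notin> B.pos"
  proof
    assume "refl_word as a \<in> B.pos"
    then have "nonneg_comb ?B (w a)" "w a \<in> roots W" using B.pos_comb B.pos_P w_eq by auto
    moreover have "nonneg_comb D d" if "d \<in> ?B" for d using that NC_base(2)[OF w] pos_comb by blast
    ultimately show False using wa nonneg_comb_trans by (auto simp: pos_def)
  qed
  then obtain us b vs where ubv: "as = us @ b # vs" "refl_word vs a = b"
    using B.exchange[OF _ aB] as by blast
  have bB: "b \<in> ?B" using as ubv by auto
  have v_eq: "v = refl_word (us @ vs)"
    unfolding v_w w_eq ubv(1) by (rule exchange_word[OF ubv(2)])
  have set_uv: "set (us @ vs) = ?B - {b}" using as das ubv by auto
  \<comment> \<open>The shortened word is minimal, so \<open>mov v\<close> is the span of its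
    letters, and these form a face of \<open>?B\<close>.\<close>
  have "length (us @ vs) = dim (mov (refl_word (us @ vs)))"
  proof -
    have "abs_length W v = dim (mov v)" using qc_abs_length NC_nc[OF v] by (simp add: nc_def)
    moreover have "abs_length W w = length as" using NC_base(4)[OF w] as das by (metis distinct_card)
    ultimately show ?thesis using cov ubv v_eq by (simp add: abs_cover_def)
  qed
  then have mv: "mov v = span (?B - {b})" using minimal_refl_word(3) v_eq set_uv by metis
  have "mov v \<subseteq> mov w" unfolding mv using NC_base(3)[OF w] span_mono[of "?B - {b}" ?B] by blast
  then have "roots W \<inter> mov w \<inter> span (?B - {b}) = roots W \<inter> mov v" using mv by blast
  then have "root_basis (roots W \<inter> mov v) (?B - {b})"
    using root_basis_face[OF NC_base(1)[OF w], of "?B - {b}"] by auto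
  then have "base (mov v) = ?B - {b}" using NC_base(2)[OF w] by (intro base_unique) auto
  then show thesis using that bB by blast
qed

text \<open>The chain is followed downwards from \<open>w\<close>: its members are below
  \<open>w\<close> in the absolute order, so they stay in \<open>NC W c\<close>.\<close>

lemma sq_order_base:
  assumes "sq_order W D v w" "w \<in> NC W c"
  shows "v \<in> NC W c \<and> base (mov v) \<subseteq> base (mov w)"
  using assms(1) unfolding sq_order_def
proof (induction rule: converse_rtranclp_induct)
  case base
  then show ?case using assms(2) by blast
next
  case (step x y)
  have le: "abs_le W x y" using step by (simp add: abs_cover_def)
  have "abs_le W y c" using step.IH by (simp only: NC_iff)
  then have x: "x \<in> NC W c" unfolding NC_iff by (rule abs_le_trans[OF le])
  from step have y: "y \<in> NC W c" "base (mov y) \<subseteq> base (mov w)"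
    and xy: "abs_cover W x y" "len x < len y" by auto
  obtain b where "base (mov x) = base (mov y) - {b}" by (rule cover_base[OF x y(1) xy])
  then show ?case using x y(2) by auto
qed

lemma base_sq_order:
  assumes "v \<in> NC W c" "w \<in> NC W c" "base (mov v) \<subseteq> base (mov w)"
  shows "sq_order W D v w"
  using assms
proof (induction "card (base (mov w) - base (mov v))" arbitrary: w)
  case 0
  have "finite (base (mov w))" using NC_base(2)[OF 0(3)] fin_pos finite_subset by blast
  then have "base (mov w) = base (mov v)" using 0 by auto
  then have "v = w" using base_inj 0 by simp
  then show ?case by (simp add: sq_order_def)
next
  case (Suc n)
  have fin: "finite (base (mov w))" using NC_base(2)[OF Suc.prems(2)] fin_pos finite_subset by blast
  obtain b where b: "b \<in> base (mov w)" "b \<notin> base (mov v)"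
    using Suc.hyps(2) by (metis DiffE card.empty equals0I nat.distinct(1))
  obtain u where u: "u \<in> NC W c" "base (mov u) = base (mov w) - {b}"
    using face_realized[OF face_subset[OF base_face[OF Suc.prems(2)], of "base (mov w) - {b}"]] by blast
  have "base (mov w) - base (mov v) = insert b (base (mov u) - base (mov v))"
    "b \<notin> base (mov u) - base (mov v)" using b u by auto
  then have "n = card (base (mov u) - base (mov v))" using Suc.hyps(2) fin u by simp
  then have "sq_order W D v u" using Suc.hyps(1) Suc.prems u b by blast
  moreover have "abs_cover W u w \<and> len u < len w"
    by (rule remove_base[OF u(1) Suc.prems(2) b(1) u(2)])
  ultimately show ?case
    unfolding sq_order_def
    using rtranclp.rtrancl_into_rtrancl[of "\<lambda>v w. abs_cover W v w \<and> len v < len w" v u w] by simp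
qed

subsection \<open>Translation to reflections\<close>

lemma pos_root_reflection:
  assumes "a \<in> pos"
  shows "pos_root D (reflection_along a) = a"
  unfolding pos_root_def
proof (rule the_equality)
  show "norm a = 1 \<and> nonneg_comb D a \<and> reflection_along a = reflection_along a"
    using assms norm_P pos_P pos_comb by blast
  fix b assume b: "norm b = 1 \<and> nonneg_comb D b \<and> reflection_along a = reflection_along b"
  have "norm a = 1" using assms norm_P pos_P by blast
  then have "a = b \<or> a = - b" using b by (intro reflection_along_eqD) auto
  then have "b = a \<or> b = - a" by auto
  moreover have "b \<in> roots W" using b pos_P[OF assms] unfolding roots_def by fastforce
  ultimately show "b = a" using b assms pos_not_neg by (auto simp: pos_def)
qed

text \<open>Fixing all fixed vectors of \<open>w\<close> means for a reflection that its root is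
  orthogonal to them, and the vectors orthogonal to the fixed space form
  \<open>mov w\<close>.\<close>

lemma roots_Gamma:
  assumes "orthogonal_transformation w"
  shows "roots (Gamma_group W w) = roots W \<inter> mov w"
proof -
  have "a \<in> mov w \<longleftrightarrow> {x. w x - x = 0} \<subseteq> {x. reflection_along a x - x = 0}" if a: "norm a = 1" for a
  proof -
    have fix_iff: "reflection_along a x - x = 0 \<longleftrightarrow> x \<bullet> a = 0" for x
      using a by (auto simp: reflection_along_unit)
    show ?thesis unfolding fix_iff
    proof
      assume "a \<in> mov w"
      then show "{x. w x - x = 0} \<subseteq> {x. x \<bullet> a = 0}" using inner_fixed_mov[OF assms] by auto
    next
      assume sub: "{x. w x - x = 0} \<subseteq> {x. x \<bullet> a = 0}"
      obtain y z where yz: "y \<in> span (mov w)" "\<And>u. u \<in> span (mov w) \<Longrightarrow> orthogonal z u" "a = y + z"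
        using orthogonal_subspace_decomp_exists[of "mov w" a] by metis
      have y: "y \<in> mov w" using yz(1) subspace_mov[OF assms] by (simp add: span_eq_iff[THEN iffD2])
      have "w z = z"
        by (rule fixed_if_orthogonal_mov[OF assms]) (use yz(2) span_base in \<open>auto simp: orthogonal_def\<close>)
      then have "z \<bullet> a = 0" using sub by auto
      moreover have "z \<bullet> y = 0" using yz by (simp add: orthogonal_def)
      ultimately have "z \<bullet> z = 0" unfolding yz(3) by (simp add: inner_add_right)
      then show "a \<in> mov w" using y yz by simp
    qed
  qed
  then show ?thesis by (auto simp: roots_def Gamma_group_def)
qed

lemma induced_eq:
  assumes "w \<in> NC W c"
  shows "induced_simple_reflections D (Gamma_group W w) = reflection_along ` base (mov w)"
proof -
  have o: "orthogonal_transformation w" using assms NC_nc nc_orthogonal by blast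
  have R: "reflections (Gamma_group W w) = reflection_along ` (pos \<inter> mov w)"
  proof -
    have "reflection_along a \<in> reflection_along ` (pos \<inter> mov w)" if "a \<in> roots W" "a \<in> mov w" for a
    proof (cases "a \<in> pos")
      case False
      then have "- a \<in> pos \<inter> mov w"
        using that pos_neg subspace_neg[OF subspace_mov[OF o]] by blast
      then show ?thesis using reflection_along_minus by (metis image_eqI)
    qed (use that in blast)
    then show ?thesis unfolding reflections_eq roots_Gamma[OF o] using pos_P by blast
  qed
  have proot: "pos_root D ` reflections (Gamma_group W w) = pos \<inter> mov w"
    unfolding R using pos_root_reflection by (force simp: image_image)
  have the_base: "(THE E. simple_system (Gamma_group W w) E \<and> E \<subseteq> pos \<inter> mov w) = base (mov w)"
  proof (rule the_equality)
    show "simple_system (Gamma_group W w) (base (mov w)) \<and> base (mov w) \<subseteq> pos \<inter> mov w"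
      using NC_base[OF assms] by (auto simp: simple_system_iff_root_basis roots_Gamma[OF o] root_basis_def)
    fix E assume "simple_system (Gamma_group W w) E \<and> E \<subseteq> pos \<inter> mov w"
    then show "E = base (mov w)"
      using base_unique[of "mov w" E] by (auto simp: simple_system_iff_root_basis roots_Gamma[OF o])
  qed
  have "induced_simple_reflections D (Gamma_group W w)
      = {t \<in> reflection_along ` (pos \<inter> mov w). pos_root D t \<in> base (mov w)}"
    unfolding induced_simple_reflections_def proot the_base unfolding R by (rule refl)
  also have "\<dots> = reflection_along ` base (mov w)"
    using NC_base[OF assms] by (auto simp: pos_root_reflection root_basis_def subset_iff)
  finally show ?thesis .
qed

text \<open>The form of the two-letter element itself vanishes at \<open>x, y\<close> by
  triangularity, and below \<open>c\<close> it is the restriction of the form of \<open>c\<close>.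
  Conversely, the vanishing makes \<open>[x, y]\<close> a triangular list for
  \<open>c\<close>.\<close>

lemma noncrossing_iff:
  assumes "a \<in> pos" "b \<in> pos" "a \<noteq> b"
  shows "noncrossing W c (reflection_along a) (reflection_along b) \<longleftrightarrow> wall c a b = 0 \<or> wall c b a = 0"
proof -
  have "abs_le W (reflection_along x \<circ> reflection_along y) c \<longleftrightarrow> wall c x y = 0"
    if xy: "x \<in> pos" "y \<in> pos" "x \<noteq> y" for x y
  proof
    have word: "reflection_along x \<circ> reflection_along y = refl_word [x, y]" by simp
    have n: "norm x = 1" using xy norm_P pos_P by blast
    assume le: "abs_le W (reflection_along x \<circ> reflection_along y) c"
    have "wall_le (refl_word [x, y]) c" by (rule abs_le_qc(2)[OF qc_c le[unfolded word]])
    moreover have i: "independent (set [x, y])"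
    proof -
      have "y \<noteq> 0" using xy P_nonzero pos_P by blast
      moreover have "x \<notin> span {y}" using pos_scalar xy by (auto simp: span_singleton)
      ultimately show ?thesis using xy by (simp add: independent_insert)
    qed
    moreover have "mov (refl_word [x, y]) = span {x, y}" using mov_refl_word[OF _ i] xy by simp
    moreover have "wall (refl_word [x, y]) x y = 0"
      by (rule wall_refl_word_hd[OF _ i n]) (use xy in \<open>auto intro: span_base\<close>)
    ultimately show "wall c x y = 0" unfolding wall_le_def by (metis insertI1 insertI2 span_base)
  next
    assume "wall c x y = 0"
    then have "abs_le W (refl_word [x, y]) c"
      using xy pos_P pos_mov_c by (intro qc_triangular(1)[OF qc_c]) auto
    then show "abs_le W (reflection_along x \<circ> reflection_along y) c" by simp
  qed
  then show ?thesis using assms by (auto simp: noncrossing_def)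
qed

lemma Xi_eq: "Xi W D c = (\<lambda>A. reflection_along ` A) ` {A. face A}"
proof
  have face_iff: "reflection_along ` A \<in> Xi W D c \<longleftrightarrow> face A" if A: "A \<subseteq> pos" for A
  proof -
    have "reflection_along ` A \<subseteq> reflections W" unfolding reflections_eq using A pos_P by blast
    moreover have "reflection_along a \<noteq> reflection_along b \<longleftrightarrow> a \<noteq> b" if "a \<in> A" "b \<in> A" for a b
      using that A inj_onD[OF reflection_inj_pos, of a b] by blast
    moreover have "pos_root D (reflection_along a) = a" if "a \<in> A" for a
      using that A pos_root_reflection by blast
    moreover have "noncrossing W c (reflection_along a) (reflection_along b) \<longleftrightarrow> wall c a b = 0 \<or> wall c b a = 0"
      if "a \<in> A" "b \<in> A" "a \<noteq> b" for a b using that A noncrossing_iff by blast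
    ultimately show ?thesis using A unfolding Xi_def face_def by auto
  qed
  show "(\<lambda>A. reflection_along ` A) ` {A. face A} \<subseteq> Xi W D c"
    using face_iff by (auto simp: face_def)
  show "Xi W D c \<subseteq> (\<lambda>A. reflection_along ` A) ` {A. face A}"
  proof
    fix X assume X: "X \<in> Xi W D c"
    define A where "A = {a \<in> pos. reflection_along a \<in> X}"
    have "t \<in> reflection_along ` A" if t: "t \<in> X" for t
    proof -
      obtain a where a: "a \<in> roots W" "t = reflection_along a"
        using t X by (auto simp: Xi_def reflections_eq)
      then obtain b where "b \<in> pos" "t = reflection_along b"
        using pos_neg[OF a(1)] reflection_along_minus by metis
      then show ?thesis using t by (auto simp: A_def)
    qed
    then have XA: "X = reflection_along ` A" by (auto simp: A_def)
    then have "face A" using X face_iff[of A] by (auto simp: A_def)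
    then show "X \<in> (\<lambda>A. reflection_along ` A) ` {A. face A}" using XA by blast
  qed
qed

lemma bij_betw_induced:
  "bij_betw (\<lambda>w. induced_simple_reflections D (Gamma_group W w)) (NC W c) (Xi W D c)"
proof (rule bij_betw_imageI)
  have image_eq: "A = B" if "A \<subseteq> pos" "B \<subseteq> pos" "reflection_along ` A = reflection_along ` B" for A B
    using inj_on_image_eq_iff[OF reflection_inj_pos] that by blast
  show "inj_on (\<lambda>w. induced_simple_reflections D (Gamma_group W w)) (NC W c)"
    using image_eq NC_base(2) base_inj by (intro inj_onI) (simp add: induced_eq)
  have "(\<lambda>w. induced_simple_reflections D (Gamma_group W w)) ` NC W c
      = (\<lambda>A. reflection_along ` A) ` (\<lambda>w. base (mov w)) ` NC W c"
    unfolding image_image by (intro image_cong refl induced_eq)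
  also have "(\<lambda>w. base (mov w)) ` NC W c = {A. face A}"
    using base_face face_realized by (auto simp: image_iff) metis
  finally show "(\<lambda>w. induced_simple_reflections D (Gamma_group W w)) ` NC W c = Xi W D c"
    by (simp add: Xi_eq)
qed

lemma sq_order_iff_induced:
  assumes "v \<in> NC W c" "w \<in> NC W c"
  shows "sq_order W D v w \<longleftrightarrow>
    induced_simple_reflections D (Gamma_group W v) \<subseteq> induced_simple_reflections D (Gamma_group W w)"
proof -
  have "reflection_along ` base (mov v) \<subseteq> reflection_along ` base (mov w) \<longleftrightarrow> base (mov v) \<subseteq> base (mov w)"
    by (rule inj_on_image_subset_iff[OF reflection_inj_pos NC_base(2)[OF assms(1)] NC_base(2)[OF assms(2)]])
  moreover have "sq_order W D v w \<longleftrightarrow> base (mov v) \<subseteq> base (mov w)"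
    using sq_order_base base_sq_order assms by blast
  ultimately show ?thesis by (simp only: induced_eq[OF assms(1)] induced_eq[OF assms(2)])
qed

end

theorem theorem4p8:
  fixes W :: "('a::euclidean_space \<Rightarrow> 'a) set"
    and D :: "'a set"
    and c :: "'a \<Rightarrow> 'a"
  assumes "finite_reflection_group W"
    and "simple_system W D"
    and "standard_coxeter_element D c"
  shows "bij_betw (\<lambda>w. induced_simple_reflections D (Gamma_group W w)) (NC W c) (Xi W D c) \<and>
    (\<forall>v\<in>NC W c. \<forall>w\<in>NC W c.
       sq_order W D v w \<longleftrightarrow>
         induced_simple_reflections D (Gamma_group W v) \<subseteq> induced_simple_reflections D (Gamma_group W w))"
proof -
  interpret R: reflection_group W using assms(1) by unfold_locales
  interpret B: based_root_sys "roots W" D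
    using assms(2) R.root_sys_roots by unfold_locales (simp_all add: simple_system_iff_root_basis)
  obtain ts where ts: "distinct ts" "set ts = reflection_along ` D" "c = word_prod ts"
    using assms(3) by (auto simp: standard_coxeter_element_def simple_reflections_def)
  \<comment> \<open>Lift the word of reflections to a word of simple roots; injectivity of
    \<open>reflection_along\<close> on \<open>D\<close> makes the lift use all of
    \<open>D\<close>.\<close>
  obtain ys where ys: "set ys \<subseteq> D" "ts = map reflection_along ys"
    using ts words_image[of ts reflection_along D] by blast
  have inj: "inj_on reflection_along D"
    using B.reflection_inj_pos B.D_pos inj_on_subset by blast
  have "reflection_along ` set ys = reflection_along ` D" using ts ys by simp
  then have "set ys = D" using inj_on_image_eq_iff[OF inj ys(1)] by simp
  moreover have "distinct ys" using ts ys by (simp add: distinct_map)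
  ultimately interpret C: coxeter_setup W D ys
    using assms(2) by unfold_locales
  have "C.c = c" using ts ys by (simp add: C.c_def)
  then show ?thesis using C.bij_betw_induced C.sq_order_iff_induced by simp
qed

end
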